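(* Let $\mathbb F\in\{\mathbb R,\mathbb C\}$, let $\mathcal X$ be a finite-dimensional normed space over $\mathbb F$ with $n=\dim\mathcal X\ge 3$, and let $x\in\Gamma(\mathcal X)$ be a vertex. Then the following conditions are equivalent: (i) The vertex $x$ corresponds to a smooth point in $\mathbb P(\mathcal X)$. (ii) There exist $n-2$ vertices $x_3,\dots,x_n\in\Gamma(\mathcal X)$ such that $$|x^\perp\cap x_3^\perp\cap\dots\cap x_n^\perp|=1$$ and, moreover, for every permutation $\sigma$ of $\{3,\dots,n\}$, setting $$\Omega_\sigma:=\Big\{y\in\Gamma(\mathcal X) :\ \big|x^\perp\cap y^\perp\cap x_{\sigma(4)}^\perp\cap\dots\cap x_{\sigma(n)}^\perp\big|=1\Big\},$$ one has $$x_{\sigma(4)}^\perp\cap\dots\cap x_{\sigma(n)}^\perp\cap x^\perp\cap\bigcap_{y\in\Omega_\sigma}y^\perp=\varnothing.$$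
   Context: For $u,v\in\mathcal X$, $u\perp v$ (Birkhoff--James orthogonality) means $\|u+\lambda v\|\ge\|u\|$ for all $\lambda\in\mathbb F$. $\Gamma(\mathcal X)$ is the directed graph whose vertex set is $\mathbb P(\mathcal X)=\{[u]=\mathbb F u : u\in\mathcal X\setminus\{0\}\}$, with an edge $[u]\rightarrow[v]$ if and only if $u\perp v$. For a vertex $x$, $x^\perp=\{y\in\Gamma(\mathcal X) : x\rightarrow y\}$. A nonzero vector $u$ is smooth if it has a unique supporting functional ($f\in\mathcal X^*$ with $\|f\|=1$, $f(u)=\|u\|$); $[u]$ is smooth if some (equivalently every) nonzero representative is smooth. When $n=3$ the sets $x_{\sigma(4)}^\perp,\dots,x_{\sigma(n)}^\perp$ are absent. *)

theory Defs
  imports "HOL-Analysis.Analysis" "Graph_Theory.Pair_Digraph"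
begin

text \<open>
  The scalar field is \<open>\<real>\<close> or \<open>\<complex>\<close>. To quantify over both cases at once, the scalars range over
  types that are copies of \<^typ>\<open>real\<close> or \<^typ>\<open>complex\<close>, i.e. identified with one of them by an
  isometric isomorphism of real algebras.
\<close>

class real_or_complex = real_normed_field +
  assumes real_or_complex:
    "(\<exists>\<phi> :: 'a \<Rightarrow> real. bij \<phi> \<and>
        (\<forall>a b. \<phi> (a + b) = \<phi> a + \<phi> b) \<and> (\<forall>a b. \<phi> (a * b) = \<phi> a * \<phi> b) \<and>
        (\<forall>r a. \<phi> (r *\<^sub>R a) = r *\<^sub>R \<phi> a) \<and> (\<forall>a. norm (\<phi> a) = norm a)) \<or>
     (\<exists>\<phi> :: 'a \<Rightarrow> complex. bij \<phi> \<and>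
        (\<forall>a b. \<phi> (a + b) = \<phi> a + \<phi> b) \<and> (\<forall>a b. \<phi> (a * b) = \<phi> a * \<phi> b) \<and>
        (\<forall>r a. \<phi> (r *\<^sub>R a) = r *\<^sub>R \<phi> a) \<and> (\<forall>a. norm (\<phi> a) = norm a))"

instance real :: real_or_complex
  by standard (rule disjI1, rule exI[of _ id], simp)

instance complex :: real_or_complex
  by standard (rule disjI2, rule exI[of _ id], simp)

text \<open>
  Every normed space over \<open>\<real>\<close> or \<open>\<complex>\<close> is a real normed space by restriction of scalars, so the norm
  is the one of the class \<^class>\<open>real_normed_vector\<close>; only the scalar multiplication is a parameter,
  and it has to extend the real one.
\<close>

locale fin_dim_normed_space = vector_space smul
  for smul :: "'f::real_or_complex \<Rightarrow> 'a::real_normed_vector \<Rightarrow> 'a" +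
  assumes smul_of_real: "smul (of_real r) u = r *\<^sub>R u"
    and norm_smul: "norm (smul c u) = norm c * norm u"
    and finite_dimensional: "\<exists>B. finite_dimensional_vector_space smul B"

lemma fin_dim_normed_space_scaleR:
  "fin_dim_normed_space (scaleR :: real \<Rightarrow> 'a \<Rightarrow> 'a::euclidean_space)"
proof (unfold_locales)
  show "\<exists>B. finite_dimensional_vector_space ((*\<^sub>R) :: real \<Rightarrow> 'a \<Rightarrow> 'a) B"
    by (rule exI, rule eucl.finite_dimensional_vector_space_axioms)
qed (auto simp: algebra_simps)

definition bj_orthogonal ::
  "('f::real_or_complex \<Rightarrow> 'a::real_normed_vector \<Rightarrow> 'a) \<Rightarrow> 'a \<Rightarrow> 'a \<Rightarrow> bool" where
  "bj_orthogonal smul u v \<longleftrightarrow> (\<forall>c. norm (u + smul c v) \<ge> norm u)"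

definition proj_point ::
  "('f::real_or_complex \<Rightarrow> 'a::real_normed_vector \<Rightarrow> 'a) \<Rightarrow> 'a \<Rightarrow> 'a set" where
  "proj_point smul u = range (\<lambda>c. smul c u)"

text \<open>
  The arcs are given by some pair of representatives; the choice does not matter, see
  \<open>arc_proj_point_iff\<close> below.
\<close>

definition bj_digraph ::
  "('f::real_or_complex \<Rightarrow> 'a::real_normed_vector \<Rightarrow> 'a) \<Rightarrow> 'a set pair_pre_digraph" where
  "bj_digraph smul =
    \<lparr> pverts = {proj_point smul u | u. u \<noteq> 0},
      parcs = {(proj_point smul u, proj_point smul v) | u v.
                 u \<noteq> 0 \<and> v \<noteq> 0 \<and> bj_orthogonal smul u v} \<rparr>"

definition perp ::
  "('f::real_or_complex \<Rightarrow> 'a::real_normed_vector \<Rightarrow> 'a) \<Rightarrow> 'a set \<Rightarrow> 'a set set" where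
  "perp smul x = {y \<in> pverts (bj_digraph smul). (x, y) \<in> parcs (bj_digraph smul)}"

definition supporting_functional ::
  "('f::real_or_complex \<Rightarrow> 'a::real_normed_vector \<Rightarrow> 'a) \<Rightarrow> 'a \<Rightarrow> ('a \<Rightarrow> 'f) \<Rightarrow> bool" where
  "supporting_functional smul u f \<longleftrightarrow>
     Vector_Spaces.linear smul (*) f \<and> bounded_linear f \<and>
     onorm f = 1 \<and> f u = of_real (norm u)"

definition smooth_vector ::
  "('f::real_or_complex \<Rightarrow> 'a::real_normed_vector \<Rightarrow> 'a) \<Rightarrow> 'a \<Rightarrow> bool" where
  "smooth_vector smul u \<longleftrightarrow> u \<noteq> 0 \<and> (\<exists>!f. supporting_functional smul u f)"

definition smooth_vertex ::
  "('f::real_or_complex \<Rightarrow> 'a::real_normed_vector \<Rightarrow> 'a) \<Rightarrow> 'a set \<Rightarrow> bool" where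
  "smooth_vertex smul x \<longleftrightarrow> (\<exists>u. u \<noteq> 0 \<and> x = proj_point smul u \<and> smooth_vector smul u)"

context fin_dim_normed_space
begin

lemma bj_orthogonal_smul:
  assumes "bj_orthogonal smul u v" "a \<noteq> 0"
  shows "bj_orthogonal smul (smul a u) (smul b v)"
  unfolding bj_orthogonal_def
proof
  fix c
  have "norm (smul a u) \<le> norm a * norm (u + smul (c * b / a) v)"
    using assms(1) by (simp add: norm_smul bj_orthogonal_def mult_left_mono)
  also have "\<dots> = norm (smul a u + smul c (smul b v))"
    using assms(2) by (simp add: scale_right_distrib flip: norm_smul)
  finally show "norm (smul a u) \<le> norm (smul a u + smul c (smul b v))" .
qed

lemma proj_point_eqD:
  assumes "proj_point smul u = proj_point smul v" "u \<noteq> 0"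
  obtains a where "a \<noteq> 0" "u = smul a v"
proof -
  have "u = smul 1 u" by simp
  then have "u \<in> proj_point smul v"
    using assms(1) unfolding proj_point_def by blast
  then obtain a where "u = smul a v" by (auto simp: proj_point_def)
  with assms(2) that show thesis by force
qed

lemma arc_proj_point_iff:
  assumes "u \<noteq> 0" "v \<noteq> 0"
  shows "(proj_point smul u, proj_point smul v) \<in> parcs (bj_digraph smul) \<longleftrightarrow>
           bj_orthogonal smul u v"
proof
  assume "(proj_point smul u, proj_point smul v) \<in> parcs (bj_digraph smul)"
  then obtain u' v' where *: "proj_point smul u = proj_point smul u'"
      "proj_point smul v = proj_point smul v'" "bj_orthogonal smul u' v'"
    by (auto simp: bj_digraph_def)
  obtain a b where "a \<noteq> 0" "u = smul a u'" "v = smul b v'"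
    using proj_point_eqD[OF *(1) assms(1)] proj_point_eqD[OF *(2) assms(2)] by metis
  then show "bj_orthogonal smul u v"
    using bj_orthogonal_smul[OF *(3)] by simp
qed (use assms in \<open>auto simp: bj_digraph_def\<close>)

end

end

theory Submission
  imports Defs
begin

text \<open>
  By James' theorem, \<open>u \<bottom> v\<close> holds iff some functional supporting at \<open>u\<close> kills \<open>v\<close>; hence \<open>[u]\<^sup>\<bottom>\<close> is the
  union of the projective hyperplanes of the kernels of these functionals, and a single hyperplane
  when \<open>u\<close> is smooth.

  If \<open>x\<close> is smooth, choose smooth \<open>x\<^sub>3, \<dots>, x\<^sub>n\<close> whose hyperplanes and that of \<open>x\<close> meet in one
  point. Dropping one of the \<open>x\<^sub>i\<close> leaves a projective line, and every point of it is avoided by the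
  hyperplane of some smooth \<open>y\<close>, because smooth points are dense; such a \<open>y\<close> belongs to \<open>\<Omega>\<^sub>\<sigma>\<close>.

  Conversely, let \<open>f \<noteq> g\<close> support at \<open>x\<close> and \<open>f\<^sub>i\<close> support at \<open>x\<^sub>i\<close>, and let \<open>[w]\<close> be the only point of
  \<open>x\<^sup>\<bottom> \<inter> x\<^sub>3\<^sup>\<bottom> \<inter> \<dots> \<inter> x\<^sub>n\<^sup>\<bottom>\<close>. Counting dimensions, \<open>f, f\<^sub>3, \<dots>, f\<^sub>n\<close> is a basis of the annihilator of
  \<open>w\<close>, which also contains \<open>g\<close>; by exchange, \<open>g\<close> can replace some \<open>f\<^sub>j\<close>. Take \<open>\<sigma>\<close> with \<open>\<sigma> 3 = j\<close>. For
  \<open>y \<in> \<Omega>\<^sub>\<sigma>\<close> and \<open>h\<close> supporting at \<open>y\<close>, the common kernels of \<open>f, h, f\<^sub>i\<close> and of \<open>g, h, f\<^sub>i\<close> (\<open>i \<noteq> j\<close>)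
  yield the same unique point, which is therefore killed by \<open>f, g, f\<^sub>i\<close> and equals \<open>[w]\<close>. So \<open>[w]\<close>
  lies in \<open>y\<^sup>\<bottom>\<close> for all \<open>y \<in> \<Omega>\<^sub>\<sigma>\<close>.
\<close>

subsection \<open>The Hahn--Banach theorem in finite dimension\<close>

definition sublinear :: "('a::real_vector \<Rightarrow> real) \<Rightarrow> bool" where
  "sublinear p \<longleftrightarrow> (\<forall>x y. p (x + y) \<le> p x + p y) \<and> (\<forall>r x. r > 0 \<longrightarrow> p (r *\<^sub>R x) = r * p x)"

lemma sublinear_add: "sublinear p \<Longrightarrow> p (x + y) \<le> p x + p y"
  and sublinear_scaleR: "sublinear p \<Longrightarrow> r > 0 \<Longrightarrow> p (r *\<^sub>R x) = r * p x"
  by (auto simp: sublinear_def)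

lemma sublinear_norm: "sublinear norm"
  by (simp add: sublinear_def norm_triangle_ineq)

lemma sublinear_zero: "sublinear p \<Longrightarrow> p 0 = 0"
  using sublinear_scaleR[of p 2 0] by simp

lemma sublinear_minus_le: "sublinear p \<Longrightarrow> - p (- x) \<le> p x"
  using sublinear_add[of p x "- x"] by (simp add: sublinear_zero)

text \<open>\<open>C\<close> is a convex cone of pairs (direction, correction), and
  \<open>q x\<close> is the infimum of \<open>p (x + k) + s\<close> over it; \<open>nonneg\<close>
  bounds this below by \<open>- p (- x)\<close>. A ray will make \<open>p\<close> odd at a vector,
  and a scalar line will give the distance to that line.\<close>

lemma sublinear_infimum:
  fixes p :: "'a::real_vector \<Rightarrow> real" and C :: "('a \<times> real) set"
  assumes p: "sublinear p" and C0: "(0, 0) \<in> C"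
    and Cadd: "\<And>z w. z \<in> C \<Longrightarrow> w \<in> C \<Longrightarrow> z + w \<in> C"
    and Cscale: "\<And>r z. r > 0 \<Longrightarrow> z \<in> C \<Longrightarrow> r *\<^sub>R z \<in> C"
    and nonneg: "\<And>k s. (k, s) \<in> C \<Longrightarrow> 0 \<le> p k + s"
  obtains q where "sublinear q" "\<And>x k s. (k, s) \<in> C \<Longrightarrow> q x \<le> p (x + k) + s"
    "\<And>x a. (\<And>k s. (k, s) \<in> C \<Longrightarrow> a \<le> p (x + k) + s) \<Longrightarrow> a \<le> q x"
proof
  let ?q = "\<lambda>x. INF z\<in>C. p (x + fst z) + snd z"
  have bdd: "bdd_below ((\<lambda>z. p (x + fst z) + snd z) ` C)" for x
  proof (rule bdd_belowI2)
    fix z assume "z \<in> C"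
    then have "0 \<le> p (fst z) + snd z"
      using nonneg[of "fst z" "snd z"] by simp
    moreover have "p (fst z) \<le> p (- x) + p (x + fst z)"
      using sublinear_add[OF p, of "- x" "x + fst z"] by simp
    ultimately show "- p (- x) \<le> p (x + fst z) + snd z" by simp
  qed
  have lower: "?q x \<le> p (x + k) + s" if "(k, s) \<in> C" for x k s
    using cINF_lower[OF bdd that, of x] by simp
  have greatest: "a \<le> ?q x" if "\<And>k s. (k, s) \<in> C \<Longrightarrow> a \<le> p (x + k) + s" for x a
    using C0 that by (intro cINF_greatest) auto
  show "?q x \<le> p (x + k) + s" if "(k, s) \<in> C" for x k s
    using lower that .
  show "a \<le> ?q x" if "\<And>k s. (k, s) \<in> C \<Longrightarrow> a \<le> p (x + k) + s" for x a
    using greatest that .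
  have add: "?q (x + y) \<le> ?q x + ?q y" for x y
  proof -
    have "?q (x + y) - (p (x + k) + s) \<le> ?q y" if k: "(k, s) \<in> C" for k s
    proof (rule greatest)
      fix l t assume "(l, t) \<in> C"
      then have "?q (x + y) \<le> p ((x + y) + (k + l)) + (s + t)"
        using Cadd[OF k, of "(l, t)"] by (intro lower) simp
      also have "\<dots> \<le> p (x + k) + p (y + l) + (s + t)"
        using sublinear_add[OF p, of "x + k" "y + l"] by (simp add: algebra_simps)
      finally show "?q (x + y) - (p (x + k) + s) \<le> p (y + l) + t" by simp
    qed
    then have "?q (x + y) - ?q y \<le> p (x + k) + s" if "(k, s) \<in> C" for k s
      using that by (simp add: algebra_simps)
    then have "?q (x + y) - ?q y \<le> ?q x" by (rule greatest)
    then show ?thesis by simp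
  qed
  have scale: "r * ?q x \<le> ?q (r *\<^sub>R x)" if r: "r > 0" for r x
  proof (rule greatest)
    fix k s assume "(k, s) \<in> C"
    then have "(inverse r *\<^sub>R k, inverse r * s) \<in> C"
      using Cscale[of "inverse r" "(k, s)"] r by simp
    then have "r * ?q x \<le> r * (p (x + inverse r *\<^sub>R k) + inverse r * s)"
      using r lower by (intro mult_left_mono) auto
    also have "\<dots> = p (r *\<^sub>R (x + inverse r *\<^sub>R k)) + s"
      unfolding sublinear_scaleR[OF p r] using r by (simp add: algebra_simps)
    also have "\<dots> = p (r *\<^sub>R x + k) + s"
      using r by (simp add: scaleR_right_distrib)
    finally show "r * ?q x \<le> p (r *\<^sub>R x + k) + s" .
  qed
  \<comment> \<open>The reverse inequality is \<open>scale\<close> for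
    \<open>inverse r\<close>.\<close>
  have "?q (r *\<^sub>R x) = r * ?q x" if r: "r > 0" for r x
  proof (rule antisym[OF _ scale[OF r]])
    have "inverse r * ?q (r *\<^sub>R x) \<le> ?q x"
      using scale[of "inverse r" "r *\<^sub>R x"] r by simp
    then show "?q (r *\<^sub>R x) \<le> r * ?q x"
      using r by (simp add: field_simps)
  qed
  with add show "sublinear ?q" unfolding sublinear_def by blast
qed

text \<open>Take the infimum of \<open>p (x + t u) - t p u\<close> over t >= 0: t = 0 gives
  \<open>q x \<le> p x\<close>, and t = 1 bounds \<open>q (- u)\<close> by \<open>- p u\<close>. The
  value at \<open>u\<close> is kept, since
  \<open>p u = - q (- u) \<le> q u \<le> p u\<close>.\<close>

lemma sublinear_odd_at:
  fixes p :: "'a::real_vector \<Rightarrow> real"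
  assumes p: "sublinear p"
  obtains q where "sublinear q" "\<And>x. q x \<le> p x" "q (- u) = - p u"
proof -
  let ?C = "(\<lambda>t. (t *\<^sub>R u, - t * p u)) ` {0..}"
  obtain q where q: "sublinear q" "\<And>x k s. (k, s) \<in> ?C \<Longrightarrow> q x \<le> p (x + k) + s"
  proof (rule sublinear_infimum[OF p, of ?C])
    show "(0, 0) \<in> ?C"
      by (rule image_eqI[of _ _ 0]) auto
    show "z + w \<in> ?C" if "z \<in> ?C" "w \<in> ?C" for z w
    proof -
      from that obtain s t where "z = (s *\<^sub>R u, - s * p u)" "w = (t *\<^sub>R u, - t * p u)" "s \<ge> 0" "t \<ge> 0"
        by auto
      then show ?thesis by (intro image_eqI[of _ _ "s + t"]) (auto simp: algebra_simps)
    qed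
    show "r *\<^sub>R z \<in> ?C" if "r > 0" "z \<in> ?C" for r z
    proof -
      from that obtain t where "z = (t *\<^sub>R u, - t * p u)" "t \<ge> 0" by auto
      then show ?thesis using that by (intro image_eqI[of _ _ "r * t"]) auto
    qed
    show "0 \<le> p k + s" if "(k, s) \<in> ?C" for k s
    proof -
      from that obtain t where "k = t *\<^sub>R u" "s = - t * p u" "t \<ge> 0" by auto
      then show ?thesis
        by (cases "t = 0") (auto simp: sublinear_zero[OF p] sublinear_scaleR[OF p])
    qed
  qed blast
  have le: "q x \<le> p x" for x
    using q(2)[OF image_eqI[of _ _ 0]] by force
  have "q (- u) \<le> p (- u + u) - p u"
    using q(2)[OF image_eqI[of _ _ 1], of u "- p u" "- u"] by simp
  moreover have "- q (- u) \<le> p u"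
    using sublinear_minus_le[OF q(1), of u] le[of u] by linarith
  ultimately have "q (- u) = - p u"
    by (simp add: sublinear_zero[OF p])
  with q(1) le that show thesis by blast
qed

lemma sublinear_odd_on:
  fixes p :: "'a::real_vector \<Rightarrow> real"
  assumes "finite S" "sublinear p"
  obtains q where "sublinear q" "\<And>x. q x \<le> p x" "\<And>u. u \<in> S \<Longrightarrow> q (- u) = - q u"
proof -
  have "\<exists>q. sublinear q \<and> (\<forall>x. q x \<le> p x) \<and> (\<forall>u\<in>S. q (- u) = - q u)"
    using assms(1)
  proof (induction S)
    case empty
    show ?case using assms(2) by auto
  next
    case (insert v S)
    then obtain q where q: "sublinear q" "\<And>x. q x \<le> p x" "\<And>u. u \<in> S \<Longrightarrow> q (- u) = - q u"
      by blast
    obtain r where r: "sublinear r" "\<And>x. r x \<le> q x" "r (- v) = - q v"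
      using sublinear_odd_at[OF q(1)] by blast
    have "r (- v) = - r v"
      using sublinear_minus_le[OF r(1), of v] r(2)[of v] r(3) by simp
    \<comment> \<open>Oddness survives passing to a smaller sublinear function:
      \<open>- q u = q (- u) \<ge> r (- u) \<ge> - r u \<ge> - q u\<close>.\<close>
    moreover have "r (- u) = - r u" if "u \<in> S" for u
      using sublinear_minus_le[OF r(1), of u] r(2)[of u] r(2)[of "- u"] q(3)[OF that] by simp
    moreover have "r x \<le> p x" for x
      using r(2)[of x] q(2)[of x] by simp
    ultimately show ?case using r(1) by auto
  qed
  with that show thesis by blast
qed

text \<open>
  A minimal sublinear functional is linear; making \<open>p\<close> odd along finitely many spanning directions,
  one after the other, replaces the use of Zorn's lemma.
\<close>

lemma hahn_banach_finite_dim: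
  fixes S :: "'a::real_vector set" and p :: "'a \<Rightarrow> real"
  assumes S: "finite S" "span S = UNIV" and p: "sublinear p"
  obtains g where "linear g" "\<And>x. g x \<le> p x" "g u = p u"
proof -
  \<comment> \<open>This pins the final value at \<open>u\<close>:
    \<open>g (- u) \<le> p' (- u) = - p u\<close> becomes \<open>p u \<le> g u\<close> once
    \<open>g\<close> is odd.\<close>
  obtain p' where p': "sublinear p'" "\<And>x. p' x \<le> p x" "p' (- u) = - p u"
    using sublinear_odd_at[OF p] by blast
  obtain g where g: "sublinear g" "\<And>x. g x \<le> p' x" "\<And>v. v \<in> S \<Longrightarrow> g (- v) = - g v"
    using sublinear_odd_on[OF S(1) p'(1)] by blast
  have "subspace {x. g (- x) = - g x}"
  proof (rule subspaceI)
    show "0 \<in> {x. g (- x) = - g x}"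
      using sublinear_zero[OF g(1)] by simp
  next
    fix x y assume xy: "x \<in> {x. g (- x) = - g x}" "y \<in> {x. g (- x) = - g x}"
    have "- g (x + y) \<le> g (- (x + y))"
      using sublinear_minus_le[OF g(1), of "x + y"] by simp
    moreover have "g (- (x + y)) \<le> - g x - g y"
      using sublinear_add[OF g(1), of "- x" "- y"] xy by simp
    moreover have "g x \<le> g (x + y) - g y"
      using sublinear_add[OF g(1), of "x + y" "- y"] xy by simp
    ultimately show "x + y \<in> {x. g (- x) = - g x}"
      using sublinear_add[OF g(1), of x y] by simp
  next
    fix c :: real and x assume x: "x \<in> {x. g (- x) = - g x}"
    consider "(c::real) = 0" | "c > 0" | "c < 0" by linarith
    then show "c *\<^sub>R x \<in> {x. g (- x) = - g x}"
    proof cases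
      case 1
      then show ?thesis using sublinear_zero[OF g(1)] by simp
    next
      case 2
      then show ?thesis
        using x sublinear_scaleR[OF g(1), of c x] sublinear_scaleR[OF g(1), of c "- x"] by simp
    next
      case 3
      then show ?thesis
        using x sublinear_scaleR[OF g(1), of "- c" x] sublinear_scaleR[OF g(1), of "- c" "- x"] by simp
    qed
  qed
  then have "span S \<subseteq> {x. g (- x) = - g x}"
    using g(3) by (intro span_minimal) auto
  then have odd: "g (- x) = - g x" for x
    using S(2) by blast
  have "linear g"
  proof (rule linearI)
    fix x y
    \<comment> \<open>Subadditivity at \<open>x\<close>, \<open>y\<close> and at \<open>- x\<close>,
      \<open>- y\<close> gives the two inequalities.\<close>
    show "g (x + y) = g x + g y"
      using sublinear_add[OF g(1), of x y] sublinear_add[OF g(1), of "- x" "- y"]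
      by (simp add: odd[of x] odd[of y] odd[of "x + y", simplified])
  next
    fix c x
    consider "(c::real) = 0" | "c > 0" | "c < 0" by linarith
    then show "g (c *\<^sub>R x) = c *\<^sub>R g x"
    proof cases
      case 3
      then show ?thesis
        using sublinear_scaleR[OF g(1), of "- c" x] odd[of "c *\<^sub>R x"] by simp
    qed (use sublinear_zero[OF g(1)] sublinear_scaleR[OF g(1)] in auto)
  qed
  moreover have "g x \<le> p x" for x
    using g(2)[of x] p'(2)[of x] by simp
  moreover have "g u = p u"
    using g(2)[of "- u"] p'(3) odd[of u] calculation(2)[of u] by simp
  ultimately show thesis using that by blast
qed

subsection \<open>The real part of a scalar\<close>

text \<open>The identity or \<open>Re\<close>, transported along the isomorphism. The last property,
  nondegeneracy of the pairing \<open>re (c * a)\<close>, is what later lifts real functionals to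
  scalar-linear ones without a case split on the field.\<close>

lemma real_or_complex_real_part:
  obtains re :: "'f::real_or_complex \<Rightarrow> real" where "linear re" "re 1 = 1" "\<And>c. \<bar>re c\<bar> \<le> norm c"
    "\<And>c. re c = norm c \<Longrightarrow> c = of_real (norm c)" "\<And>\<psi> :: 'f \<Rightarrow> real. linear \<psi> \<Longrightarrow> \<exists>a. \<forall>c. re (c * a) = \<psi> c"
proof -
  have "\<exists>re :: 'f \<Rightarrow> real. linear re \<and> re 1 = 1 \<and> (\<forall>c. \<bar>re c\<bar> \<le> norm c) \<and>
          (\<forall>c. re c = norm c \<longrightarrow> c = of_real (norm c)) \<and>
          (\<forall>\<psi> :: 'f \<Rightarrow> real. linear \<psi> \<longrightarrow> (\<exists>a. \<forall>c. re (c * a) = \<psi> c))"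
    using real_or_complex[where 'a = 'f]
  proof (elim disjE exE conjE)
    fix \<phi> :: "'f \<Rightarrow> real"
    assume \<phi>: "bij \<phi>" "\<forall>a b. \<phi> (a + b) = \<phi> a + \<phi> b" "\<forall>a b. \<phi> (a * b) = \<phi> a * \<phi> b"
      "\<forall>r a. \<phi> (r *\<^sub>R a) = r *\<^sub>R \<phi> a" "\<forall>a. norm (\<phi> a) = norm a"
    have one: "\<phi> 1 = 1"
      using \<phi>(3,5) by (metis mult_cancel_left1 mult_1 norm_eq_zero zero_neq_one)
    have "\<exists>a. \<forall>c. \<phi> (c * a) = \<psi> c" if \<psi>: "linear \<psi>" for \<psi> :: "'f \<Rightarrow> real"
    proof (intro exI allI)
      fix c
      have "\<phi> c *\<^sub>R 1 = c"
        using \<phi>(1,4) one by (metis bij_pointE mult.right_neutral real_scaleR_def)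
      then have "\<psi> c = \<phi> c * \<psi> 1"
        using linear_cmul[OF \<psi>, of "\<phi> c" 1] by simp
      then show "\<phi> (c * (\<psi> 1 *\<^sub>R 1)) = \<psi> c"
        using \<phi>(3,4) one by simp
    qed
    moreover have "linear \<phi>" using \<phi>(2,4) by (intro linearI) auto
    moreover have "c = of_real (norm c)" if "\<phi> c = norm c" for c
    proof -
      have "\<phi> c = \<phi> (of_real (norm c))"
        using that \<phi>(4) one by (simp add: of_real_def)
      then show ?thesis using \<phi>(1) by (metis bij_pointE)
    qed
    ultimately show ?thesis using \<phi>(5) one by (intro exI[of _ \<phi>]) simp
  next
    fix \<phi> :: "'f \<Rightarrow> complex"
    assume \<phi>: "bij \<phi>" "\<forall>a b. \<phi> (a + b) = \<phi> a + \<phi> b" "\<forall>a b. \<phi> (a * b) = \<phi> a * \<phi> b"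
      "\<forall>r a. \<phi> (r *\<^sub>R a) = r *\<^sub>R \<phi> a" "\<forall>a. norm (\<phi> a) = norm a"
    have one: "\<phi> 1 = 1"
      using \<phi>(3,5) by (metis mult_cancel_left1 mult_1 norm_eq_zero zero_neq_one)
    obtain j where j: "\<phi> j = \<i>" using \<phi>(1) by (metis bij_pointE)
    have "\<exists>a. \<forall>c. Re (\<phi> (c * a)) = \<psi> c" if \<psi>: "linear \<psi>" for \<psi> :: "'f \<Rightarrow> real"
    proof (intro exI allI)
      fix c
      have "\<phi> (Re (\<phi> c) *\<^sub>R 1 + Im (\<phi> c) *\<^sub>R j) = \<phi> c"
        using \<phi>(2,4) one j by (simp add: complex_eq_iff)
      then have "c = Re (\<phi> c) *\<^sub>R 1 + Im (\<phi> c) *\<^sub>R j"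
        using \<phi>(1) by (metis bij_pointE)
      then have "\<psi> c = Re (\<phi> c) * \<psi> 1 + Im (\<phi> c) * \<psi> j"
        using linear_add[OF \<psi>, of "Re (\<phi> c) *\<^sub>R 1" "Im (\<phi> c) *\<^sub>R j"] linear_cmul[OF \<psi>] by simp
      \<comment> \<open>With \<open>j\<close> the preimage of the imaginary unit, Re ((s + t i)(a -
        b i)) = s a + t b dictates the representing scalar.\<close>
      then show "Re (\<phi> (c * (\<psi> 1 *\<^sub>R 1 + (- \<psi> j) *\<^sub>R j))) = \<psi> c"
        unfolding \<phi>(3)[rule_format] \<phi>(2)[rule_format] \<phi>(4)[rule_format] one j by simp
    qed
    moreover have "linear (\<lambda>c. Re (\<phi> c))" using \<phi>(2,4) by (intro linearI) auto
    moreover have "\<bar>Re (\<phi> c)\<bar> \<le> norm c" for c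
      using abs_Re_le_cmod[of "\<phi> c"] \<phi>(5) by simp
    moreover have "c = of_real (norm c)" if "Re (\<phi> c) = norm c" for c
    proof -
      have "Im (\<phi> c) = 0"
        using that \<phi>(5) cmod_power2[of "\<phi> c"] by simp
      then have "\<phi> c = \<phi> (of_real (norm c))"
        using that \<phi>(4) one by (simp add: of_real_def complex_eq_iff)
      then show ?thesis using \<phi>(1) by (metis bij_pointE)
    qed
    ultimately show ?thesis using one by (intro exI[of _ "\<lambda>c. Re (\<phi> c)"]) simp
  qed
  with that show thesis by blast
qed

lemma real_or_complex_finite_span:
  obtains E :: "'f::real_or_complex set" where "finite E" "span E = UNIV"
proof -
  have "\<exists>E :: 'f set. finite E \<and> span E = UNIV"
    using real_or_complex[where 'a = 'f]
  proof (elim disjE exE conjE)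
    fix \<phi> :: "'f \<Rightarrow> real"
    assume \<phi>: "bij \<phi>" "\<forall>r a. \<phi> (r *\<^sub>R a) = r *\<^sub>R \<phi> a"
    obtain e where e: "\<phi> e = 1" using \<phi>(1) by (metis bij_pointE)
    have "c \<in> span {e}" for c
    proof -
      have "c = \<phi> c *\<^sub>R e"
        using \<phi> e by (metis bij_pointE mult.right_neutral real_scaleR_def)
      then show ?thesis by (metis insertI1 span_base span_scale)
    qed
    then show ?thesis by (intro exI[of _ "{e}"]) auto
  next
    fix \<phi> :: "'f \<Rightarrow> complex"
    assume \<phi>: "bij \<phi>" "\<forall>a b. \<phi> (a + b) = \<phi> a + \<phi> b" "\<forall>r a. \<phi> (r *\<^sub>R a) = r *\<^sub>R \<phi> a"
    obtain e where e: "\<phi> e = 1" using \<phi>(1) by (metis bij_pointE)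
    obtain j where j: "\<phi> j = \<i>" using \<phi>(1) by (metis bij_pointE)
    have "c \<in> span {e, j}" for c
    proof -
      have "\<phi> (Re (\<phi> c) *\<^sub>R e + Im (\<phi> c) *\<^sub>R j) = \<phi> c"
        using \<phi>(2,3) e j by (simp add: complex_eq_iff)
      then have "c = Re (\<phi> c) *\<^sub>R e + Im (\<phi> c) *\<^sub>R j"
        using \<phi>(1) by (metis bij_pointE)
      moreover have "Re (\<phi> c) *\<^sub>R e + Im (\<phi> c) *\<^sub>R j \<in> span {e, j}"
        by (intro span_add span_scale span_base) auto
      ultimately show ?thesis by simp
    qed
    then show ?thesis by (intro exI[of _ "{e, j}"]) auto
  qed
  with that show thesis by blast
qed

subsection \<open>Finite-dimensional real normed spaces\<close>

text \<open>The norm of a combination has a positive minimum on the compact sphere of coefficients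
  with maximum modulus 1; rescaling extends the bound to all coefficients.\<close>

lemma coordinates_bounded:
  fixes B :: "'a::real_normed_vector set"
  assumes B: "finite B" "independent B"
  obtains K where "K > 0" "\<And>c b. b \<in> B \<Longrightarrow> \<bar>c b\<bar> \<le> K * norm (\<Sum>b\<in>B. c b *\<^sub>R b)"
proof (cases "B = {}")
  case True
  with that[of 1] show thesis by simp
next
  case False
  define T where "T c = (\<Sum>b\<in>B. c b *\<^sub>R b)" for c :: "'a \<Rightarrow> real"
  \<comment> \<open>Coefficients are functions on the whole type; forcing them to vanish off
    \<open>B\<close> makes \<open>box\<close> a product of compact sets.\<close>
  define box where "box = (PiE UNIV (\<lambda>b. if b \<in> B then {-1..1} else {0}) :: ('a \<Rightarrow> real) set)"
  define S where "S = (\<Union>b\<in>B. {c \<in> box. \<bar>c b\<bar> = 1})"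
  have "compactin (product_topology (\<lambda>_. euclidean) UNIV) box"
    unfolding box_def compactin_PiE by auto
  then have box: "compact box"
    by (simp add: euclidean_product_topology)
  have S: "compact S" unfolding S_def
  proof (intro compact_UN B(1))
    fix b assume "b \<in> B"
    have "closed {c :: 'a \<Rightarrow> real. \<bar>c b\<bar> = 1}"
      by (intro closed_Collect_eq continuous_intros continuous_on_product_coordinates)
    then have "compact (box \<inter> {c. \<bar>c b\<bar> = 1})"
      using box by (rule compact_Int_closed[rotated])
    then show "compact {c \<in> box. \<bar>c b\<bar> = 1}"
      by (simp add: Int_def)
  qed
  have cont: "continuous_on S (\<lambda>c. norm (T c))"
    unfolding T_def
    by (intro continuous_intros continuous_on_subset[OF continuous_on_product_coordinates]) auto
  have "S \<noteq> {}"
  proof -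
    obtain b where "b \<in> B" using False by auto
    then have "(\<lambda>x. if x = b then 1 else 0) \<in> S"
      unfolding S_def box_def by (auto intro!: bexI[of _ b])
    then show ?thesis by blast
  qed
  then obtain c0 where c0: "c0 \<in> S" "\<And>c. c \<in> S \<Longrightarrow> norm (T c0) \<le> norm (T c)"
    using continuous_attains_inf[OF S _ cont] by blast
  have "T c0 \<noteq> 0"
  proof
    assume "T c0 = 0"
    then have "\<forall>b\<in>B. c0 b = 0"
      using independentD[OF B(2,1) subset_refl] unfolding T_def by blast
    then show False using c0(1) by (auto simp: S_def)
  qed
  then have m: "norm (T c0) > 0" by simp
  show thesis
  proof (rule that[of "inverse (norm (T c0))"])
    fix c :: "'a \<Rightarrow> real" and b assume b: "b \<in> B"
    define M where "M = Max ((\<lambda>b. \<bar>c b\<bar>) ` B)"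
    obtain b0 where b0: "b0 \<in> B" "M = \<bar>c b0\<bar>"
      using Max_in[of "(\<lambda>b. \<bar>c b\<bar>) ` B"] B(1) False unfolding M_def by blast
    have le: "\<bar>c b\<bar> \<le> M" if "b \<in> B" for b
      unfolding M_def using B(1) that by simp
    have "M * norm (T c0) \<le> norm (T c)"
    proof (cases "M = 0")
      case False
      then have M: "M > 0" using b0 by simp
      \<comment> \<open>Dividing by the largest modulus and cutting off outside \<open>B\<close>
        puts the coefficients on the sphere \<open>S\<close>.\<close>
      define d where "d x = (if x \<in> B then c x / M else 0)" for x
      have "d x \<in> {-1..1}" if "x \<in> B" for x
        using le[OF that] M that by (auto simp: d_def field_simps abs_le_iff)
      moreover have "d x = 0" if "x \<notin> B" for x
        using that by (simp add: d_def)
      ultimately have "d \<in> box"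
        unfolding box_def by (intro PiE_I) (simp_all split: if_split)
      moreover have "\<bar>d b0\<bar> = 1" using b0 M by (auto simp: d_def)
      ultimately have "d \<in> S" unfolding S_def using b0(1) by auto
      then have "norm (T c0) \<le> norm (T d)" by (rule c0(2))
      also have "T d = inverse M *\<^sub>R T c"
        unfolding T_def scaleR_sum_right by (intro sum.cong) (auto simp: d_def divide_inverse mult.commute)
      finally show ?thesis using M by (simp add: field_simps)
    qed simp
    then have "M \<le> inverse (norm (T c0)) * norm (T c)"
      using m by (simp add: field_simps)
    then show "\<bar>c b\<bar> \<le> inverse (norm (T c0)) * norm (\<Sum>b\<in>B. c b *\<^sub>R b)"
      using le[OF b] by (simp add: T_def)
  qed (use m in simp)
qed

text \<open>Bounded coordinates place the ball inside the continuous image of a compact box, in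
  which it is closed.\<close>

lemma compact_cball_finite_dim:
  fixes S :: "'a::real_normed_vector set"
  assumes "finite S" "span S = UNIV"
  shows "compact (cball (a::'a) r)"
proof -
  obtain B where B: "B \<subseteq> S" "independent B" "span S = span B"
    by (metis maximal_independent_subset span_eq span_mono span_superset subset_antisym span_span)
  then have fin: "finite B" "span B = UNIV"
    using assms finite_subset by auto
  obtain K where K: "K > 0" "\<And>c b. b \<in> B \<Longrightarrow> \<bar>c b\<bar> \<le> K * norm (\<Sum>b\<in>B. c b *\<^sub>R b)"
    using coordinates_bounded[OF fin(1) B(2)] by blast
  define T where "T c = (\<Sum>b\<in>B. c b *\<^sub>R b)" for c :: "'a \<Rightarrow> real"
  define R where "R = K * (norm a + r)"
  define box where "box = (PiE UNIV (\<lambda>b. if b \<in> B then {-R..R} else {0}) :: ('a \<Rightarrow> real) set)"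
  have "compactin (product_topology (\<lambda>_. euclidean) UNIV) box"
    unfolding box_def compactin_PiE by auto
  then have "compact box"
    by (simp add: euclidean_product_topology)
  moreover have "continuous_on box T"
    unfolding T_def
    by (intro continuous_intros continuous_on_subset[OF continuous_on_product_coordinates]) auto
  ultimately have "compact (T ` box)" by (rule compact_continuous_image[rotated])
  moreover have "cball a r \<subseteq> T ` box"
  proof
    fix x assume x: "x \<in> cball a r"
    have "x \<in> span B" using fin by simp
    then obtain c where c: "x = (\<Sum>b\<in>B. c b *\<^sub>R b)"
      using span_finite[OF fin(1)] by auto
    define d where "d b = (if b \<in> B then c b else 0)" for b
    have "norm x \<le> norm a + r"
      using x norm_triangle_sub[of x a] by (simp add: dist_norm norm_minus_commute)
    then have "\<bar>c b\<bar> \<le> R" if "b \<in> B" for b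
      using K(2)[OF that, of c] K(1) c unfolding R_def
      by (smt (verit) mult_left_mono)
    then have "d \<in> box" by (auto simp: box_def d_def abs_le_iff) force
    moreover have "x = T d" unfolding c T_def by (intro sum.cong) (auto simp: d_def)
    ultimately show "x \<in> T ` box" by blast
  qed
  ultimately have "compact (T ` box \<inter> cball a r)"
    by (intro compact_Int_closed) auto
  then show ?thesis
    using \<open>cball a r \<subseteq> T ` box\<close> by (simp add: inf_absorb2)
qed

text \<open>
  If a small ball, with respect to a Euclidean norm, lies in the open unit ball and its boundary
  touches the unit sphere at \<open>y\<close>, then any functional supporting the unit ball at \<open>y\<close> also supports
  the Euclidean ball there, which determines it. Centring the ball near \<open>w\<close> makes \<open>y\<close> close to \<open>w\<close>.
\<close>

lemma unique_support_near:
  fixes S :: "'a::real_normed_vector set"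
  assumes S: "finite S" "span S = UNIV" and w: "norm (w :: 'a) = 1"
  obtains y where "norm y \<ge> 1" "norm (y - w) < 1"
    "\<And>g h. linear g \<Longrightarrow> linear h \<Longrightarrow> (\<And>x. g x \<le> norm x) \<Longrightarrow> (\<And>x. h x \<le> norm x) \<Longrightarrow>
       g y = norm y \<Longrightarrow> h y = norm y \<Longrightarrow> g = h"
proof -
  obtain B where B: "B \<subseteq> S" "independent B" "span S = span B"
    by (metis maximal_independent_subset span_eq span_mono span_superset subset_antisym span_span)
  then have fin: "finite B" and span: "span B = UNIV"
    using S finite_subset by auto
  obtain K where K: "K > 0" "\<And>c b. b \<in> B \<Longrightarrow> \<bar>c b\<bar> \<le> K * norm (\<Sum>b\<in>B. c b *\<^sub>R b)"
    using coordinates_bounded[OF fin B(2)] by blast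
  define co where "co b x = representation B x b" for b x
  have sum_co: "(\<Sum>b\<in>B. co b x *\<^sub>R b) = x" for x
    unfolding co_def using real_vector.sum_representation_eq[OF B(2) _ fin subset_refl, of x] span by simp
  have co_le: "\<bar>co b x\<bar> \<le> norm x * K" if "b \<in> B" for b x
    using K(2)[OF that, of "\<lambda>b. co b x"] by (simp add: sum_co mult.commute)
  have co_add: "co b (x + y) = co b x + co b y" for b x y
    unfolding co_def using B(2) span by (simp add: real_vector.representation_add)
  have co_scale: "co b (r *\<^sub>R x) = r * co b x" for b x r
    unfolding co_def using B(2) span by (simp add: real_vector.representation_scale)
  have "bounded_linear (co b)" if "b \<in> B" for b
    by (rule bounded_linear_intro[of _ K]) (use co_add co_scale co_le[OF that] in auto)
  then have cont_co: "continuous_on A (co b)" if "b \<in> B" for b A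
    using that by (intro linear_continuous_on)

  \<comment> \<open>The inner product for which \<open>B\<close> is orthonormal; it supplies the
    Euclidean ball.\<close>
  define ip where "ip x y = (\<Sum>b\<in>B. co b x * co b y)" for x y
  have ip_commute: "ip x y = ip y x" for x y
    by (simp add: ip_def mult.commute)
  have ip_add: "ip x (y + z) = ip x y + ip x z" for x y z
    by (simp add: ip_def co_add algebra_simps sum.distrib)
  have ip_scale: "ip x (r *\<^sub>R y) = r * ip x y" for x y r
    by (simp add: ip_def co_scale algebra_simps sum_distrib_left)
  have ip_linear: "linear (ip x)" for x
    by (intro linearI) (simp_all add: ip_add ip_scale)
  have ip_nonneg: "ip x x \<ge> 0" for x
    by (simp add: ip_def sum_nonneg)
  have norm_le: "norm x \<le> (\<Sum>b\<in>B. norm b) * sqrt (ip x x)" for x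
  proof -
    have "norm x \<le> (\<Sum>b\<in>B. \<bar>co b x\<bar> * norm b)"
      using norm_sum[of "\<lambda>b. co b x *\<^sub>R b" B] by (simp add: sum_co)
    also have "\<dots> \<le> (\<Sum>b\<in>B. sqrt (ip x x) * norm b)"
    proof (intro sum_mono mult_right_mono)
      fix b assume "b \<in> B"
      then have "(co b x)\<^sup>2 \<le> ip x x"
        unfolding ip_def using member_le_sum[of b B "\<lambda>b. co b x * co b x"] fin
        by (simp add: power2_eq_square)
      then show "\<bar>co b x\<bar> \<le> sqrt (ip x x)"
        by (rule real_le_rsqrt[of "\<bar>co b x\<bar>", simplified])
    qed simp
    finally show ?thesis by (simp add: sum_distrib_right mult.commute)
  qed
  define L where "L = (\<Sum>b\<in>B. norm b)"
  have L: "L \<ge> 0" by (simp add: L_def sum_nonneg)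
  have ip_pos: "ip x x > 0" if "x \<noteq> 0" for x
    using norm_le[of x] ip_nonneg[of x] that by (cases "ip x x = 0") auto

  \<comment> \<open>The choice makes \<open>\<epsilon> * (1 + L * sqrt (ip w w)) < 1\<close>. By
    \<open>near\<close>, this keeps every vector that is Euclidean-closer to the centre
    \<open>p\<close> than \<open>w\<close>, or equally close, within norm distance 1 of
    \<open>w\<close>.\<close>
  define \<epsilon> where "\<epsilon> = 1 / (2 + L * sqrt (ip w w))"
  have \<epsilon>: "\<epsilon> > 0" "\<epsilon> < 1" "\<epsilon> * (1 + L * sqrt (ip w w)) < 1"
    using mult_nonneg_nonneg[OF L real_sqrt_ge_zero[OF ip_nonneg[of w]]]
    by (auto simp: \<epsilon>_def field_simps)
  define p where "p = (1 - \<epsilon>) *\<^sub>R w"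
  have norm_p: "norm p < 1"
    using \<epsilon> w by (simp add: p_def)
  have wp: "w - p = \<epsilon> *\<^sub>R w"
    by (simp add: p_def algebra_simps)
  have near: "norm (z - w) < 1" if "ip (z - p) (z - p) \<le> ip (w - p) (w - p)" for z
  proof -
    have "ip (w - p) (w - p) = \<epsilon>\<^sup>2 * ip w w"
      unfolding wp ip_scale ip_commute[of "\<epsilon> *\<^sub>R w"] by (simp add: power2_eq_square)
    then have "sqrt (ip (w - p) (w - p)) = \<epsilon> * sqrt (ip w w)"
      using \<epsilon> by (simp add: real_sqrt_mult)
    then have "L * sqrt (ip (z - p) (z - p)) \<le> L * (\<epsilon> * sqrt (ip w w))"
      using that L by (metis mult_left_mono real_sqrt_le_iff)
    then have "norm (z - p) \<le> L * (\<epsilon> * sqrt (ip w w))"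
      using norm_le[of "z - p"] unfolding L_def[symmetric] by simp
    moreover have "norm (z - w) \<le> norm (z - p) + norm (w - p)"
      using norm_triangle_ineq4[of "z - p" "w - p"] by simp
    moreover have "norm (w - p) = \<epsilon>"
      using \<epsilon> w by (simp add: wp)
    ultimately show ?thesis using \<epsilon>(3) by (simp add: algebra_simps)
  qed

  \<comment> \<open>The vector outside the open unit ball that is Euclidean-nearest to
    \<open>p\<close> is sought here. Intersecting with \<open>cball w 1\<close> gives compactness
    and, by \<open>near\<close>, loses no competitor.\<close>
  define D where "D = cball w 1 \<inter> {z. norm z \<ge> 1}"
  have "compact D"
    unfolding D_def by (intro compact_Int_closed compact_cball_finite_dim[OF S] closed_Collect_le continuous_intros)
  moreover have "continuous_on D (\<lambda>z. ip (z - p) (z - p))"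
    unfolding ip_def
    by (intro continuous_intros continuous_on_compose2[OF cont_co[of _ UNIV]]) auto
  moreover have "w \<in> D" using w by (simp add: D_def)
  ultimately obtain y where y: "y \<in> D" "\<And>z. z \<in> D \<Longrightarrow> ip (y - p) (y - p) \<le> ip (z - p) (z - p)"
    using continuous_attains_inf[of D "\<lambda>z. ip (z - p) (z - p)"] by blast
  have yw: "ip (y - p) (y - p) \<le> ip (w - p) (w - p)"
    using y(2)[OF \<open>w \<in> D\<close>] .
  have inside: "norm z < 1" if "ip (z - p) (z - p) < ip (y - p) (y - p)" for z
  proof (rule ccontr)
    assume "\<not> norm z < 1"
    moreover have "norm (z - w) < 1" using near[of z] that yw by simp
    ultimately have "z \<in> D"
      by (simp add: D_def dist_norm norm_minus_commute)
    then show False using y(2)[of z] that by simp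
  qed
  define q where "q = y - p"
  have y1: "norm y \<ge> 1" using y(1) by (simp add: D_def)
  then have "q \<noteq> 0" using norm_p by (auto simp: q_def)
  then have q: "ip q q > 0" by (rule ip_pos)

  \<comment> \<open>If \<open>g v > 0\<close>, moving from \<open>y\<close> along \<open>v\<close>
    and slightly towards \<open>p\<close> enters the Euclidean ball, where the norm is below 1,
    without decreasing \<open>g\<close>; but \<open>g y = norm y \<ge> 1\<close>.\<close>
  have tangent: "g v \<le> 0"
    if g: "linear g" "\<And>x. g x \<le> norm x" "g y = norm y" and v: "ip q v = 0" for g v
  proof (rule ccontr)
    assume "\<not> g v \<le> 0"
    then have gv: "g v > 0" by simp
    \<comment> \<open>The slope \<open>\<eta>\<close> is small enough that the inward motion costs
      \<open>g\<close> no more than the motion along \<open>v\<close> gains.\<close>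
    define \<eta> where "\<eta> = g v / (\<bar>g q\<bar> + 1)"
    have \<eta>: "\<eta> > 0" "\<eta> * g q \<le> g v"
    proof -
      show "\<eta> > 0" using gv by (simp add: \<eta>_def)
      then have "\<eta> * g q \<le> \<eta> * (\<bar>g q\<bar> + 1)" by (intro mult_left_mono) auto
      also have "\<dots> = g v" by (simp add: \<eta>_def)
      finally show "\<eta> * g q \<le> g v" .
    qed
    define d where "d = ip v v + \<eta>\<^sup>2 * ip q q"
    have d: "d > 0" using \<eta> q ip_nonneg[of v] by (simp add: d_def add_nonneg_pos)
    \<comment> \<open>The minimiser of the squared Euclidean distance
      \<open>ip q q - 2 * t * \<eta> * ip q q + t * t * d\<close>.\<close>
    define t where "t = \<eta> * ip q q / d"
    have t: "t > 0" using \<eta> q d by (simp add: t_def)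
    define z where "z = y + t *\<^sub>R v + (- (t * \<eta>)) *\<^sub>R q"
    have zp: "z - p = (1 - t * \<eta>) *\<^sub>R q + t *\<^sub>R v"
      by (simp add: z_def q_def algebra_simps)
    have "ip (z - p) (z - p) = (1 - t * \<eta>) * ((1 - t * \<eta>) * ip q q) + t * (t * ip v v)"
      unfolding zp ip_add ip_scale ip_commute[of "_ + _"] v ip_commute[of v q] by simp
    also have "\<dots> = ip q q - 2 * t * \<eta> * ip q q + t * (t * d)"
      by (simp add: d_def power2_eq_square algebra_simps)
    also have "t * d = \<eta> * ip q q" using d by (simp add: t_def)
    also have "ip q q - 2 * t * \<eta> * ip q q + t * (\<eta> * ip q q) = ip q q - t * \<eta> * ip q q"
      by simp
    also have "\<dots> < ip q q" using t \<eta> q by simp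
    finally have "norm z < 1" using inside[of z] by (simp add: q_def)
    then have "g z < g y" using g(2)[of z] g(3) y1 by simp
    also have "g z = g y + t * (g v - \<eta> * g q)"
      unfolding z_def linear_add[OF g(1)] linear_cmul[OF g(1)] by (simp add: algebra_simps)
    finally have "t * (g v - \<eta> * g q) < 0" by simp
    then show False using t \<eta>(2) by (simp add: mult_less_0_iff)
  qed
  have support: "g v * ip q q = ip q v * g q" if g: "linear g" "\<And>x. g x \<le> norm x" "g y = norm y" for g v
  proof -
    \<comment> \<open>Up to the factor \<open>ip q q\<close>, the component of \<open>v\<close>
      orthogonal to \<open>q\<close>; \<open>tangent\<close> for \<open>u\<close> and
      \<open>- u\<close> forces \<open>g u = 0\<close>. So \<open>g\<close> is a multiple of
      \<open>ip q\<close>.\<close>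
    define u where "u = ip q q *\<^sub>R v + (- ip q v) *\<^sub>R q"
    have u: "ip q u = 0" unfolding u_def ip_add ip_scale by simp
    moreover have "ip q (- u) = 0" using u linear_neg[OF ip_linear] by simp
    ultimately have "g u = 0"
      using tangent[OF g] tangent[OF g, of "- u"] linear_neg[OF g(1)] by fastforce
    then show ?thesis
      unfolding u_def linear_add[OF g(1)] linear_cmul[OF g(1)] by (simp add: mult.commute)
  qed
  show thesis
  proof (rule that[of y])
    show "norm y \<ge> 1" by (rule y1)
    show "norm (y - w) < 1" using near yw .
    fix g h
    assume g: "linear g" "\<And>x. g x \<le> norm x" "g y = norm y"
      and h: "linear h" "\<And>x. h x \<le> norm x" "h y = norm y"
    have gy: "norm y * ip q q = ip q y * g q" and hy: "norm y * ip q q = ip q y * h q"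
      using support[OF g, of y] support[OF h, of y] g h by auto
    \<comment> \<open>The remaining factor \<open>g q\<close> is fixed by the value
      \<open>norm y\<close> at \<open>y\<close>.\<close>
    have "ip q y \<noteq> 0" using gy q y1 by auto
    then have "g q = h q" using gy hy by simp
    then have "g v * ip q q = h v * ip q q" for v
      using support[OF g, of v] support[OF h, of v] by simp
    then show "g = h" using q by (intro ext) (metis mult_right_cancel less_irrefl)
  qed
qed

subsection \<open>Supporting functionals\<close>

text \<open>The class only asserts that some isomorphism exists, so the real part is selected by the
  properties that later arguments need.\<close>

definition real_part :: "'f::real_or_complex \<Rightarrow> real" where
  "real_part = (SOME re. linear re \<and> re 1 = 1 \<and> (\<forall>c. \<bar>re c\<bar> \<le> norm c) \<and>
     (\<forall>c. re c = norm c \<longrightarrow> c = of_real (norm c)) \<and>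
     (\<forall>\<psi>. linear \<psi> \<longrightarrow> (\<exists>a. \<forall>c. re (c * a) = \<psi> c)))"

lemma linear_real_part: "linear (real_part :: 'f::real_or_complex \<Rightarrow> real)"
  and real_part_one: "real_part (1 :: 'f) = 1"
  and abs_real_part_le: "\<bar>real_part c\<bar> \<le> norm (c :: 'f)"
  and real_part_eq_norm: "real_part c = norm c \<Longrightarrow> c = of_real (norm (c :: 'f))"
  and real_part_represents: "linear \<psi> \<Longrightarrow> \<exists>a :: 'f. \<forall>c. real_part (c * a) = \<psi> c"
proof -
  have "\<exists>re :: 'f \<Rightarrow> real. linear re \<and> re 1 = 1 \<and> (\<forall>c. \<bar>re c\<bar> \<le> norm c) \<and>
     (\<forall>c. re c = norm c \<longrightarrow> c = of_real (norm c)) \<and>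
     (\<forall>\<psi>. linear \<psi> \<longrightarrow> (\<exists>a. \<forall>c. re (c * a) = \<psi> c))"
    using real_or_complex_real_part by metis
  from someI_ex[OF this, folded real_part_def]
  show "linear (real_part :: 'f \<Rightarrow> real)" "real_part (1 :: 'f) = 1" "\<bar>real_part c\<bar> \<le> norm (c :: 'f)"
    "real_part c = norm c \<Longrightarrow> c = of_real (norm (c :: 'f))"
    "linear \<psi> \<Longrightarrow> \<exists>a :: 'f. \<forall>c. real_part (c * a) = \<psi> c"
    by blast+
qed

lemma real_part_of_real: "real_part (of_real r :: 'f::real_or_complex) = r"
  by (simp add: of_real_def linear_cmul[OF linear_real_part] real_part_one)

lemma real_part_mult_eq_0:
  assumes "\<And>c. real_part (c * a) = 0"
  shows "a = (0 :: 'f::real_or_complex)"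
proof (rule ccontr)
  assume "a \<noteq> 0"
  then show False using assms[of "inverse a"] by (simp add: real_part_one)
qed

sublocale fin_dim_normed_space \<subseteq>
  finite_dimensional_vector_space smul "SOME B. finite_dimensional_vector_space smul B"
  using finite_dimensional by (rule someI_ex)

context fin_dim_normed_space
begin

abbreviation scalar_linear :: "('a \<Rightarrow> 'f) \<Rightarrow> bool" where
  "scalar_linear \<equiv> Vector_Spaces.linear smul (*)"

lemma scalar_linearI:
  assumes "\<And>x y. f (x + y) = f x + f y" "\<And>c x. f (smul c x) = c * f x"
  shows "scalar_linear f"
  by (intro Vector_Spaces.linear.intro module_hom.intro module_hom_axioms.intro)
     (use assms in \<open>unfold_locales; simp add: algebra_simps\<close>)+

lemma
  assumes "scalar_linear f"
  shows scalar_linear_add: "f (x + y) = f x + f y"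
    and scalar_linear_smul: "f (smul c x) = c * f x"
    and scalar_linear_zero: "f 0 = 0"
    and scalar_linear_diff: "f (x - y) = f x - f y"
    and scalar_linear_sum: "f (sum h A) = (\<Sum>a\<in>A. f (h a))"
proof -
  interpret Vector_Spaces.linear smul "(*)" f by fact
  show "f (x + y) = f x + f y" "f (smul c x) = c * f x" "f 0 = 0" "f (x - y) = f x - f y"
    "f (sum h A) = (\<Sum>a\<in>A. f (h a))"
    by (simp_all add: add scale diff sum)
qed

lemma smul_scaleR_left: "smul (r *\<^sub>R c) x = r *\<^sub>R smul c x"
  by (metis scale_scale scaleR_conv_of_real smul_of_real)

text \<open>Restriction of scalars: products of real generators of the field with a basis over the
  field. The Hahn-Banach and compactness results above are real and need such a set.\<close>

lemma finite_real_span: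
  obtains S :: "'a set" where "finite S" "Real_Vector_Spaces.span S = UNIV"
proof -
  obtain E :: "'f set" where E: "finite E" "Real_Vector_Spaces.span E = UNIV"
    using real_or_complex_finite_span .
  obtain B where B: "finite B" "span B = UNIV"
    using finiteI_independent independent_Basis span_Basis by blast
  define S where "S = (\<lambda>(e, b). smul e b) ` (E \<times> B)"
  have smul_in: "smul c b \<in> Real_Vector_Spaces.span S" if b: "b \<in> B" for b c
  proof -
    have "real_vector.subspace {c. smul c b \<in> Real_Vector_Spaces.span S}"
      by (intro real_vector.subspaceI)
         (auto simp: scale_left_distrib smul_scaleR_left intro: real_vector.span_add real_vector.span_scale real_vector.span_zero)
    moreover have "E \<subseteq> {c. smul c b \<in> Real_Vector_Spaces.span S}"
      using b by (auto simp: S_def intro!: real_vector.span_base)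
    ultimately have "Real_Vector_Spaces.span E \<subseteq> {c. smul c b \<in> Real_Vector_Spaces.span S}"
      by (intro real_vector.span_minimal)
    then show ?thesis using E(2) by blast
  qed
  have "x \<in> Real_Vector_Spaces.span S" for x
  proof -
    obtain r where "x = (\<Sum>b\<in>B. smul (r b) b)"
      using span_finite[OF B(1)] B(2) by auto
    then show ?thesis using smul_in by (auto intro: real_vector.span_sum)
  qed
  moreover have "finite S" unfolding S_def using E(1) B(1) by simp
  ultimately show thesis using that by blast
qed

lemma real_part_linear:
  assumes "scalar_linear f"
  shows "linear (\<lambda>x. real_part (f x))"
  by (intro linearI)
     (simp_all add: scalar_linear_add[OF assms] scalar_linear_smul[OF assms] linear_add[OF linear_real_part]
       linear_cmul[OF linear_real_part] flip: smul_of_real scaleR_conv_of_real)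

text \<open>Evaluating at \<open>smul c x\<close> recovers the real part of every multiple
  \<open>c * f x\<close>, hence \<open>f x\<close> itself.\<close>

lemma scalar_linear_eqI:
  assumes f: "scalar_linear f" and g: "scalar_linear g" and eq: "\<And>x. real_part (f x) = real_part (g x)"
  shows "f = g"
proof
  fix x
  have "real_part (c * (f x - g x)) = 0" for c
    using eq[of "smul c x"]
    by (simp add: scalar_linear_smul[OF f] scalar_linear_smul[OF g] right_diff_distrib
        linear_diff[OF linear_real_part])
  then show "f x = g x" using real_part_mult_eq_0 by fastforce
qed

text \<open>\<open>f x\<close> is the scalar representing the real functional sending
  \<open>c\<close> to \<open>g (smul c x)\<close>. Over the complex numbers this is g(x) - i g(i
  x).\<close>

lemma scalar_linear_extension:
  assumes g: "linear g"
  obtains f where "scalar_linear f" "\<And>x. real_part (f x) = g x"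
proof -
  have "\<exists>a. \<forall>c. real_part (c * a) = g (smul c x)" for x
    by (rule real_part_represents)
       (auto intro!: linearI simp: scale_left_distrib smul_scaleR_left linear_add[OF g] linear_cmul[OF g])
  then obtain f where f: "\<And>x c. real_part (c * f x) = g (smul c x)"
    by metis
  have "f (x + y) = f x + f y" for x y
  proof -
    have "real_part (c * (f (x + y) - (f x + f y))) = 0" for c
      by (simp add: right_diff_distrib distrib_left linear_diff[OF linear_real_part]
          linear_add[OF linear_real_part] f scale_right_distrib linear_add[OF g])
    then show ?thesis using real_part_mult_eq_0 by fastforce
  qed
  moreover have "f (smul d x) = d * f x" for d x
  proof -
    have "real_part (c * (f (smul d x) - d * f x)) = 0" for c
      using f[of "c * d" x] by (simp add: right_diff_distrib linear_diff[OF linear_real_part] f mult.assoc)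
    then show ?thesis using real_part_mult_eq_0 by fastforce
  qed
  ultimately have "scalar_linear f" by (rule scalar_linearI)
  moreover have "real_part (f x) = g x" for x
    using f[of 1 x] by simp
  ultimately show thesis using that by blast
qed

lemma norm_le_of_real_part_le:
  assumes f: "scalar_linear f" and le: "\<And>x. real_part (f x) \<le> norm x"
  shows "norm (f x) \<le> norm x"
proof (cases "f x = 0")
  case False
  \<comment> \<open>A scalar of modulus 1 that rotates \<open>f x\<close> onto the nonnegative real
    axis, where the real part is the norm.\<close>
  define c where "c = of_real (norm (f x)) / f x"
  have "f (smul c x) = of_real (norm (f x))"
    using False by (simp add: scalar_linear_smul[OF f] c_def)
  then have "norm (f x) = real_part (f (smul c x))"
    by (simp add: real_part_of_real)
  also have "\<dots> \<le> norm c * norm x"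
    using le[of "smul c x"] by (simp add: norm_smul)
  also have "norm c = 1" using False by (simp add: c_def norm_divide)
  finally show ?thesis by simp
qed simp

text \<open>A pointwise bound replaces \<open>onorm f = 1\<close>: the value at the nonzero
  \<open>u\<close> already forces \<open>onorm f \<ge> 1\<close>.\<close>

lemma supporting_functional_iff:
  assumes "u \<noteq> 0"
  shows "supporting_functional smul u f \<longleftrightarrow>
    scalar_linear f \<and> (\<forall>x. norm (f x) \<le> norm x) \<and> f u = of_real (norm u)"
proof
  assume "supporting_functional smul u f"
  then show "scalar_linear f \<and> (\<forall>x. norm (f x) \<le> norm x) \<and> f u = of_real (norm u)"
    using onorm[of f] by (auto simp: supporting_functional_def)
next
  assume *: "scalar_linear f \<and> (\<forall>x. norm (f x) \<le> norm x) \<and> f u = of_real (norm u)"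
  then have f: "scalar_linear f" and le: "\<And>x. norm (f x) \<le> norm x" and fu: "f u = of_real (norm u)"
    by auto
  have bl: "bounded_linear f"
    by (rule bounded_linear_intro[of _ 1])
       (use le in \<open>simp_all add: scalar_linear_add[OF f] scalar_linear_smul[OF f] scaleR_conv_of_real flip: smul_of_real\<close>)
  have "onorm f \<le> 1" by (rule onorm_bound) (use le in auto)
  moreover have "norm u \<le> onorm f * norm u"
    using onorm[OF bl, of u] fu by simp
  then have "1 \<le> onorm f" using assms by simp
  ultimately show "supporting_functional smul u f"
    using f fu bl by (simp add: supporting_functional_def)
qed

text \<open>James' characterisation. A supporting \<open>f\<close> killing \<open>v\<close> gives
  \<open>norm u = norm (f (u + smul c v)) \<le> norm (u + smul c v)\<close>. Conversely,
  orthogonality says that \<open>u\<close> has distance \<open>norm u\<close> from the line of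
  \<open>v\<close>, and Hahn-Banach is applied to this distance.\<close>

lemma bj_orthogonal_iff_supporting_functional:
  assumes u: "u \<noteq> 0"
  shows "bj_orthogonal smul u v \<longleftrightarrow> (\<exists>f. supporting_functional smul u f \<and> f v = 0)"
proof
  assume "\<exists>f. supporting_functional smul u f \<and> f v = 0"
  then obtain f where f: "scalar_linear f" "\<And>x. norm (f x) \<le> norm x" "f u = of_real (norm u)" "f v = 0"
    using supporting_functional_iff[OF u] by blast
  have "norm u \<le> norm (u + smul c v)" for c
    using f(2)[of "u + smul c v"] by (simp add: scalar_linear_add[OF f(1)] scalar_linear_smul[OF f(1)] f(3,4))
  then show "bj_orthogonal smul u v" by (simp add: bj_orthogonal_def)
next
  assume orth: "bj_orthogonal smul u v"
  \<comment> \<open>With zero corrections, \<open>q x\<close> is the distance from \<open>x\<close>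
    to the scalar line through \<open>v\<close>.\<close>
  let ?C = "range (\<lambda>c. (smul c v, 0 :: real))"
  obtain q where q: "sublinear q" "\<And>x k s. (k, s) \<in> ?C \<Longrightarrow> q x \<le> norm (x + k) + s"
    "\<And>x a. (\<And>k s. (k, s) \<in> ?C \<Longrightarrow> a \<le> norm (x + k) + s) \<Longrightarrow> a \<le> q x"
  proof (rule sublinear_infimum[OF sublinear_norm, of ?C])
    show "(0, 0) \<in> ?C" by (rule image_eqI[of _ _ 0]) auto
    show "z + w \<in> ?C" if "z \<in> ?C" "w \<in> ?C" for z w
      using that by (auto simp flip: scale_left_distrib)
    show "r *\<^sub>R z \<in> ?C" if "r > 0" "z \<in> ?C" for r z
      using that by (auto simp flip: smul_scaleR_left)
    show "0 \<le> norm k + s" if "(k, s) \<in> ?C" for k s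
      using that by auto
  qed blast
  obtain S :: "'a set" where S: "finite S" "Real_Vector_Spaces.span S = UNIV"
    using finite_real_span .
  obtain g where g: "linear g" "\<And>x. g x \<le> q x" "g u = q u"
    using hahn_banach_finite_dim[OF S q(1)] by blast
  obtain f where f: "scalar_linear f" "\<And>x. real_part (f x) = g x"
    using scalar_linear_extension[OF g(1)] by blast
  have q_le: "q x \<le> norm (x + smul c v)" for x c
    using q(2)[of "smul c v" 0 x, OF rangeI] by simp
  have "g x \<le> norm x" for x
    using g(2)[of x] q_le[of x 0] by simp
  then have le: "norm (f x) \<le> norm x" for x
    using norm_le_of_real_part_le[OF f(1)] f(2) by simp
  have "q u = norm u"
  proof (rule antisym)
    show "q u \<le> norm u" using q_le[of u 0] by simp
    show "norm u \<le> q u"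
      by (rule q(3)) (use orth in \<open>auto simp: bj_orthogonal_def\<close>)
  qed
  then have "real_part (f u) = norm u" using f(2) g(3) by simp
  moreover from this have "norm (f u) = norm u"
    using le[of u] abs_real_part_le[of "f u"] by simp
  ultimately have fu: "f u = of_real (norm u)"
    using real_part_eq_norm[of "f u"] by simp
  \<comment> \<open>The distance vanishes on the line itself; a real-linear \<open>g\<close> that is
    nonpositive at a vector and at its negative is zero there.\<close>
  have g_le: "g (smul c v) \<le> 0" for c
    using g(2)[of "smul c v"] q_le[of "smul c v" "- c"] by simp
  have "real_part (c * f v) = 0" for c
    using g_le[of c] g_le[of "- c"] f(2)[of "smul c v"] linear_neg[OF g(1), of "smul c v"]
    by (simp add: scalar_linear_smul[OF f(1)])
  then have "f v = 0" using real_part_mult_eq_0 by blast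
  with f(1) le fu show "\<exists>f. supporting_functional smul u f \<and> f v = 0"
    using supporting_functional_iff[OF u] by blast
qed

lemma supporting_functional_exists:
  assumes "u \<noteq> 0"
  obtains f where "supporting_functional smul u f"
  \<comment> \<open>Every vector is orthogonal to 0.\<close>
  using bj_orthogonal_iff_supporting_functional[OF assms, of 0] by (auto simp: bj_orthogonal_def)

text \<open>The form in which density of smooth points is used. The smooth \<open>y\<close> lies at
  distance less than 1 from the normalised \<open>w'\<close>; if \<open>f w' = 0\<close>, then
  \<open>norm y = norm (f (y - w')) < 1\<close>, although \<open>norm y \<ge> 1\<close>.\<close>

lemma smooth_vector_not_annihilating:
  assumes "w \<noteq> 0"
  obtains y f where "smooth_vector smul y" "supporting_functional smul y f" "f w \<noteq> 0"
proof -
  obtain S :: "'a set" where S: "finite S" "Real_Vector_Spaces.span S = UNIV"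
    using finite_real_span .
  define w' where "w' = inverse (norm w) *\<^sub>R w"
  have "norm w' = 1" using assms by (simp add: w'_def)
  then obtain y where y: "norm y \<ge> 1" "norm (y - w') < 1"
    "\<And>g h. linear g \<Longrightarrow> linear h \<Longrightarrow> (\<And>x. g x \<le> norm x) \<Longrightarrow> (\<And>x. h x \<le> norm x) \<Longrightarrow>
       g y = norm y \<Longrightarrow> h y = norm y \<Longrightarrow> g = h"
    using unique_support_near[OF S] by blast
  have y0: "y \<noteq> 0" using y(1) by auto
  obtain f where f: "supporting_functional smul y f"
    using supporting_functional_exists[OF y0] .
  \<comment> \<open>Uniqueness is known for real functionals and passes to scalar-linear ones
    through their real parts.\<close>
  have "f' = f" if f': "supporting_functional smul y f'" for f'
  proof -
    have real: "linear (\<lambda>x. real_part (h x))" "\<And>x. real_part (h x) \<le> norm x" "real_part (h y) = norm y"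
      "scalar_linear h" if "supporting_functional smul y h" for h
    proof -
      have h: "scalar_linear h" "\<And>x. norm (h x) \<le> norm x" "h y = of_real (norm y)"
        using that supporting_functional_iff[OF y0] by auto
      show "linear (\<lambda>x. real_part (h x))" "scalar_linear h"
        using real_part_linear h(1) by auto
      show "real_part (h x) \<le> norm x" for x
        using abs_real_part_le[of "h x"] h(2)[of x] by linarith
      show "real_part (h y) = norm y" by (simp add: h(3) real_part_of_real)
    qed
    have "(\<lambda>x. real_part (f' x)) = (\<lambda>x. real_part (f x))"
      using y(3) real[OF f] real[OF f'] by blast
    then show ?thesis
      using scalar_linear_eqI[OF real(4)[OF f'] real(4)[OF f]] by meson
  qed
  then have smooth: "smooth_vector smul y"
    using f y0 by (auto simp: smooth_vector_def)
  have f': "scalar_linear f" "\<And>x. norm (f x) \<le> norm x" "f y = of_real (norm y)"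
    using f supporting_functional_iff[OF y0] by auto
  have "f w \<noteq> 0"
  proof
    assume "f w = 0"
    then have "f w' = 0"
      by (simp add: w'_def scalar_linear_smul[OF f'(1)] flip: smul_of_real)
    then have "norm y = norm (f (y - w'))"
      by (simp add: scalar_linear_diff[OF f'(1)] f'(3))
    then show False using f'(2)[of "y - w'"] y by linarith
  qed
  with smooth f that show thesis by blast
qed

end

subsection \<open>Neighbourhoods as unions of projective hyperplanes\<close>

context fin_dim_normed_space
begin

section \<open>Projective points of a subspace\<close>

definition points :: "'a set \<Rightarrow> 'a set set" where
  "points V = proj_point smul ` (V - {0})"

lemma proj_point_smul:
  assumes "c \<noteq> 0"
  shows "proj_point smul (smul c u) = proj_point smul u"
  unfolding proj_point_def
proof (safe intro!: image_eqI)
  fix a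
  show "smul a (smul c u) = smul (a * c) u" by simp
  show "smul a u = smul (a / c) (smul c u)" using assms by simp
qed auto

lemma proj_point_in_points_iff:
  assumes "subspace V" "v \<noteq> 0"
  shows "proj_point smul v \<in> points V \<longleftrightarrow> v \<in> V"
proof
  assume "proj_point smul v \<in> points V"
  then obtain w where "w \<in> V" "proj_point smul v = proj_point smul w"
    by (auto simp: points_def)
  then show "v \<in> V"
    using proj_point_eqD[of v w] assms by (metis subspace_scale)
qed (use assms in \<open>auto simp: points_def\<close>)

lemma pverts_eq_points: "pverts (bj_digraph smul) = points UNIV"
  by (auto simp: bj_digraph_def points_def)

lemma pointsE:
  assumes "z \<in> points V"
  obtains v where "v \<in> V" "v \<noteq> 0" "z = proj_point smul v"
  using assms by (auto simp: points_def)

text \<open>Intersections of projective subspaces reduce to linear ones. The separate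
  \<open>U\<close> keeps the formula valid for empty \<open>I\<close>, which occurs when n =
  3.\<close>

lemma points_Int_INT:
  assumes "subspace U" "\<And>i. i \<in> I \<Longrightarrow> subspace (K i)"
  shows "points U \<inter> (\<Inter>i\<in>I. points (K i)) = points (U \<inter> (\<Inter>i\<in>I. K i))"
proof (rule set_eqI)
  fix z
  show "z \<in> points U \<inter> (\<Inter>i\<in>I. points (K i)) \<longleftrightarrow> z \<in> points (U \<inter> (\<Inter>i\<in>I. K i))"
  proof (cases "z \<in> points UNIV")
    case True
    then obtain v where v: "v \<noteq> 0" "z = proj_point smul v" by (auto elim: pointsE)
    have "subspace (U \<inter> (\<Inter>i\<in>I. K i))"
      using assms by (intro subspace_inter subspace_Int) auto
    then show ?thesis
      using v assms by (simp add: proj_point_in_points_iff)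
  qed (auto simp: points_def)
qed

lemma points_Int:
  assumes "subspace U" "subspace V"
  shows "points U \<inter> points V = points (U \<inter> V)"
  using points_Int_INT[of U "{()}" "\<lambda>_. V"] assms by simp

lemma card_points_dim_1:
  assumes "subspace V" "dim V = 1"
  shows "card (points V) = 1"
proof -
  obtain B where B: "B \<subseteq> V" "independent B" "V \<subseteq> span B" "card B = 1"
    using basis_exists[of V] assms(2) by auto
  then obtain b where b: "B = {b}" by (auto simp: card_1_singleton_iff)
  have b0: "b \<noteq> 0" using B(2) b dependent_zero by blast
  have "points V = {proj_point smul b}"
  proof (intro equalityI subsetI)
    fix z assume "z \<in> points V"
    then obtain v where v: "v \<in> V" "v \<noteq> 0" "z = proj_point smul v" by (rule pointsE)
    then obtain k where k: "v = smul k b" using B(3) b by (auto simp: span_singleton)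
    with v(2) have "k \<noteq> 0" by auto
    then show "z \<in> {proj_point smul b}" using v(3) k proj_point_smul by simp
  qed (use B(1) b b0 in \<open>auto simp: points_def\<close>)
  then show ?thesis by simp
qed

lemma points_subset_singletonD:
  assumes "points V \<subseteq> {proj_point smul w}"
  shows "V \<subseteq> span {w}"
proof
  fix v assume v: "v \<in> V"
  show "v \<in> span {w}"
  proof (cases "v = 0")
    case False
    with v assms have "proj_point smul v = proj_point smul w" by (auto simp: points_def)
    then show ?thesis using proj_point_eqD[of v w] False by (metis span_base span_scale singletonI)
  qed (simp add: span_zero)
qed

lemma points_nonempty:
  assumes "dim V \<ge> 1"
  shows "points V \<noteq> {}"
  using assms dim_eq_0[of V] by (fastforce simp: points_def)

section \<open>Kernels of functionals and dimension counts\<close>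

lemma subspace_kernel: "scalar_linear f \<Longrightarrow> subspace {v. f v = 0}"
  by (rule subspaceI) (auto simp: scalar_linear_add scalar_linear_smul scalar_linear_zero)

text \<open>Modulo \<open>w\<close>, every vector of \<open>V\<close> can be corrected into the
  kernel: \<open>w\<close> spans a complement.\<close>

lemma dim_eq_dim_kernel:
  assumes V: "subspace V" and f: "scalar_linear f" and w: "w \<in> V" "f w \<noteq> 0"
  shows "dim V = dim (V \<inter> {v. f v = 0}) + 1"
proof -
  let ?U = "V \<inter> {v. f v = 0}"
  have U: "subspace ?U" by (intro subspace_inter V subspace_kernel f)
  have "V \<subseteq> span (insert w ?U)"
  proof
    fix v assume v: "v \<in> V"
    have "v - smul (f v / f w) w \<in> ?U"
      using v w V by (auto simp: scalar_linear_diff[OF f] scalar_linear_smul[OF f]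
          intro: subspace_diff subspace_scale)
    then show "v \<in> span (insert w ?U)"
      unfolding span_breakdown_eq by (intro exI span_base)
  qed
  moreover have "span (insert w ?U) \<subseteq> V"
    using V w by (intro span_minimal) auto
  ultimately have "dim V = dim (insert w ?U)"
    by (metis dim_span subset_antisym)
  moreover have "w \<notin> span ?U"
    unfolding span_eq_iff[THEN iffD2, OF U] using w(2) by simp
  ultimately show ?thesis by (simp add: dim_insert)
qed

lemma dim_le_dim_kernel:
  assumes "subspace V" "scalar_linear f"
  shows "dim V \<le> dim (V \<inter> {v. f v = 0}) + 1"
proof (cases "\<exists>w\<in>V. f w \<noteq> 0")
  case True
  then show ?thesis using dim_eq_dim_kernel[OF assms] by fastforce
next
  case False
  then have "V \<inter> {v. f v = 0} = V" by auto
  then show ?thesis by simp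
qed

lemma dim_le_dim_INT_kernels:
  assumes "finite I" "subspace V" "\<And>i. i \<in> I \<Longrightarrow> scalar_linear (F i)"
  shows "dim V \<le> dim (V \<inter> (\<Inter>i\<in>I. {v. F i v = 0})) + card I"
  using assms(1,3)
proof (induction I)
  case (insert i I)
  let ?U = "V \<inter> (\<Inter>i\<in>I. {v. F i v = 0})"
  have "subspace ?U"
    using insert.prems assms(2) by (intro subspace_inter subspace_Int subspace_kernel) auto
  then have "dim ?U \<le> dim (?U \<inter> {v. F i v = 0}) + 1"
    using insert.prems by (intro dim_le_dim_kernel) auto
  moreover have "?U \<inter> {v. F i v = 0} = V \<inter> (\<Inter>i\<in>insert i I. {v. F i v = 0})"
    by auto
  ultimately show ?case using insert by simp
qed simp

section \<open>Neighbourhoods and hyperplanes\<close>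

lemma supporting_functional_linear:
  assumes "supporting_functional smul u f"
  shows "scalar_linear f"
  using assms by (simp add: supporting_functional_def)

lemma proj_point_in_perp_iff:
  assumes "u \<noteq> 0" "v \<noteq> 0"
  shows "proj_point smul v \<in> perp smul (proj_point smul u) \<longleftrightarrow> bj_orthogonal smul u v"
proof -
  have "proj_point smul v \<in> pverts (bj_digraph smul)"
    using assms(2) by (auto simp: bj_digraph_def)
  then show ?thesis by (simp add: perp_def arc_proj_point_iff[OF assms])
qed

lemma points_kernel_subset_perp:
  assumes "u \<noteq> 0" "supporting_functional smul u f"
  shows "points {v. f v = 0} \<subseteq> perp smul (proj_point smul u)"
proof
  fix z assume "z \<in> points {v. f v = 0}"
  then obtain v where "f v = 0" "v \<noteq> 0" "z = proj_point smul v"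
    by (auto elim: pointsE)
  then show "z \<in> perp smul (proj_point smul u)"
    using assms by (auto simp: proj_point_in_perp_iff bj_orthogonal_iff_supporting_functional)
qed

text \<open>Uniqueness of the supporting functional reduces the union of hyperplanes to a single
  one.\<close>

lemma perp_smooth_vector:
  assumes "smooth_vector smul u" "supporting_functional smul u f"
  shows "perp smul (proj_point smul u) = points {v. f v = 0}"
proof (intro equalityI subsetI)
  fix z assume z: "z \<in> perp smul (proj_point smul u)"
  then obtain v where v: "v \<noteq> 0" "z = proj_point smul v"
    by (auto simp: perp_def bj_digraph_def)
  have u: "u \<noteq> 0" using assms(1) by (simp add: smooth_vector_def)
  then obtain f' where "supporting_functional smul u f'" "f' v = 0"
    using z v by (auto simp: proj_point_in_perp_iff bj_orthogonal_iff_supporting_functional)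
  then have "f v = 0"
    using assms by (auto simp: smooth_vector_def)
  then show "z \<in> points {v. f v = 0}" using v by (auto simp: points_def)
next
  show "z \<in> perp smul (proj_point smul u)" if "z \<in> points {v. f v = 0}" for z
    using points_kernel_subset_perp[of u f] assms that by (auto simp: smooth_vector_def)
qed

text \<open>Each step picks a nonzero vector of the current subspace and a smooth point whose
  functional does not kill it, so the dimension drops by exactly one. The induction varies
  \<open>V\<close> for this reason.\<close>

lemma smooth_vectors_cut_line:
  assumes "finite I" "subspace V" "dim V = card I + 1"
  obtains y F where "\<And>i. i \<in> I \<Longrightarrow> smooth_vector smul (y i)"
    "\<And>i. i \<in> I \<Longrightarrow> supporting_functional smul (y i) (F i)"
    "dim (V \<inter> (\<Inter>i\<in>I. {v. F i v = 0})) = 1"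
proof -
  have "\<exists>y F. (\<forall>i\<in>I. smooth_vector smul (y i) \<and> supporting_functional smul (y i) (F i)) \<and>
    dim (V \<inter> (\<Inter>i\<in>I. {v. F i v = 0})) = 1"
    using assms
  proof (induction I arbitrary: V)
    case (insert j I)
    then have "\<not> V \<subseteq> {0}" using dim_eq_0[of V] by simp
    then obtain w where w: "w \<in> V" "w \<noteq> 0" by auto
    obtain a f where a: "smooth_vector smul a" "supporting_functional smul a f" "f w \<noteq> 0"
      using smooth_vector_not_annihilating[OF w(2)] .
    have f: "scalar_linear f" using supporting_functional_linear[OF a(2)] .
    let ?U = "V \<inter> {v. f v = 0}"
    have "subspace ?U" by (intro subspace_inter insert.prems subspace_kernel f)
    moreover have "dim ?U = card I + 1"
      using dim_eq_dim_kernel[OF insert.prems(1) f w(1) a(3)] insert by simp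
    ultimately obtain y F where yF: "\<forall>i\<in>I. smooth_vector smul (y i) \<and> supporting_functional smul (y i) (F i)"
      "dim (?U \<inter> (\<Inter>i\<in>I. {v. F i v = 0})) = 1"
      using insert.IH by blast
    have "(\<Inter>i\<in>I. {v. (F(j := f)) i v = 0}) = (\<Inter>i\<in>I. {v. F i v = 0})"
      using insert.hyps(2) by (intro INF_cong refl) auto
    then have *: "V \<inter> (\<Inter>i\<in>insert j I. {v. (F(j := f)) i v = 0}) = ?U \<inter> (\<Inter>i\<in>I. {v. F i v = 0})"
      by (simp add: Int_assoc)
    show ?case
    proof (intro exI conjI ballI)
      show "dim (V \<inter> (\<Inter>i\<in>insert j I. {v. (F(j := f)) i v = 0})) = 1"
        unfolding * by (rule yF(2))
      show "smooth_vector smul ((y(j := a)) i)" "supporting_functional smul ((y(j := a)) i) ((F(j := f)) i)"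
        if "i \<in> insert j I" for i
        using that yF(1) a(1,2) by auto
    qed
  qed simp
  with that show thesis by blast
qed

section \<open>From smoothness to the choice of vertices\<close>

lemma smooth_imp_vertices:
  assumes n: "n = dim (UNIV :: 'a set)" "n \<ge> 3" and u: "smooth_vector smul u"
  shows "\<exists>xs :: nat \<Rightarrow> 'a set.
       (\<forall>i\<in>{3..n}. xs i \<in> pverts (bj_digraph smul)) \<and>
       card (perp smul (proj_point smul u) \<inter> (\<Inter>i\<in>{3..n}. perp smul (xs i))) = 1 \<and>
       (\<forall>\<sigma>. \<sigma> permutes {3..n} \<longrightarrow>
          (let \<Omega> = {y \<in> pverts (bj_digraph smul).
                      card (perp smul (proj_point smul u) \<inter> perp smul y \<inter>
                            (\<Inter>i\<in>{4..n}. perp smul (xs (\<sigma> i)))) = 1}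
           in (\<Inter>i\<in>{4..n}. perp smul (xs (\<sigma> i))) \<inter> perp smul (proj_point smul u) \<inter>
                (\<Inter>y\<in>\<Omega>. perp smul y) = {}))"
proof -
  have u0: "u \<noteq> 0" using u by (simp add: smooth_vector_def)
  obtain f where fu: "supporting_functional smul u f"
    using supporting_functional_exists[OF u0] .
  have f: "scalar_linear f" "f u \<noteq> 0"
    using fu u0 by (auto simp: supporting_functional_def)
  define V where "V = {v. f v = 0}"
  have V: "subspace V" unfolding V_def by (rule subspace_kernel[OF f(1)])
  have dimV: "dim V + 1 = n"
    using dim_eq_dim_kernel[OF subspace_UNIV f(1) _ f(2)] n by (simp add: V_def)
  have perpV: "perp smul (proj_point smul u) = points V"
    unfolding V_def by (rule perp_smooth_vector[OF u fu])
  have "dim V = card {3..n} + 1" using dimV n by simp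
  then obtain y F where y: "\<And>i. i \<in> {3..n} \<Longrightarrow> smooth_vector smul (y i)"
    and F: "\<And>i. i \<in> {3..n} \<Longrightarrow> supporting_functional smul (y i) (F i)"
    and dim1: "dim (V \<inter> (\<Inter>i\<in>{3..n}. {v. F i v = 0})) = 1"
    using smooth_vectors_cut_line[OF _ V] by blast
  define K where "K i = {v. F i v = 0}" for i
  have K: "subspace (K i)" if "i \<in> {3..n}" for i
    unfolding K_def using F[OF that] by (intro subspace_kernel supporting_functional_linear)
  define xs where "xs i = proj_point smul (y i)" for i
  have xs: "perp smul (xs i) = points (K i)" if "i \<in> {3..n}" for i
    unfolding xs_def K_def using perp_smooth_vector[OF y[OF that] F[OF that]] .
  show ?thesis
  proof (intro exI[of _ xs] conjI ballI allI impI)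
    show "xs i \<in> pverts (bj_digraph smul)" if "i \<in> {3..n}" for i
      using y[OF that] by (auto simp: xs_def bj_digraph_def smooth_vector_def)
    have "perp smul (proj_point smul u) \<inter> (\<Inter>i\<in>{3..n}. perp smul (xs i)) = points V \<inter> (\<Inter>i\<in>{3..n}. points (K i))"
      using perpV xs by simp
    also have "\<dots> = points (V \<inter> (\<Inter>i\<in>{3..n}. K i))"
      by (rule points_Int_INT[OF V K])
    finally show "card (perp smul (proj_point smul u) \<inter> (\<Inter>i\<in>{3..n}. perp smul (xs i))) = 1"
      using card_points_dim_1 dim1 V K unfolding K_def
      by (metis (no_types, lifting) subspace_inter subspace_Int)
  next
    fix \<sigma> assume \<sigma>: "\<sigma> permutes {3..n}"
    have \<sigma>_in: "\<sigma> i \<in> {3..n}" if "i \<in> {4..n}" for i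
      using permutes_in_image[OF \<sigma>, of i] that by simp
    define L where "L = V \<inter> (\<Inter>i\<in>{4..n}. K (\<sigma> i))"
    have L: "subspace L"
      unfolding L_def using K \<sigma>_in by (intro subspace_inter V subspace_Int) blast
    have perpL: "perp smul (proj_point smul u) \<inter> (\<Inter>i\<in>{4..n}. perp smul (xs (\<sigma> i))) = points L"
    proof -
      have "perp smul (proj_point smul u) \<inter> (\<Inter>i\<in>{4..n}. perp smul (xs (\<sigma> i))) =
          points V \<inter> (\<Inter>i\<in>{4..n}. points (K (\<sigma> i)))"
        using perpV xs \<sigma>_in by simp
      also have "\<dots> = points L"
        unfolding L_def using K \<sigma>_in by (intro points_Int_INT V) blast
      finally show ?thesis .
    qed
    \<comment> \<open>Restoring the omitted kernel of \<open>F (\<sigma> 3)\<close> leaves dimension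
      1, so \<open>L\<close> has dimension at most 2; conversely, n - 3 kernels cut down the (n -
      1)-dimensional \<open>V\<close>.\<close>
    have "dim L = 2"
    proof (rule antisym)
      have \<sigma>3: "\<sigma> 3 \<in> {3..n}" using permutes_in_image[OF \<sigma>, of 3] n by simp
      have "{3..n} = \<sigma> ` insert 3 {4..n}"
        using permutes_image[OF \<sigma>] n(2) by (simp add: atLeastAtMost_insertL[symmetric] numeral_eq_Suc)
      then have "V \<inter> (\<Inter>i\<in>{3..n}. K i) = L \<inter> {v. F (\<sigma> 3) v = 0}"
        unfolding L_def K_def by auto
      then have "dim (L \<inter> {v. F (\<sigma> 3) v = 0}) = 1" using dim1 by (simp add: K_def)
      then show "dim L \<le> 2"
        using dim_le_dim_kernel[OF L supporting_functional_linear[OF F[OF \<sigma>3]]] by simp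
      have "dim V \<le> dim L + card {4..n}"
        unfolding L_def K_def using F \<sigma>_in supporting_functional_linear
        by (intro dim_le_dim_INT_kernels V) blast+
      then show "2 \<le> dim L" using dimV n by simp
    qed
    show "let \<Omega> = {y \<in> pverts (bj_digraph smul).
                      card (perp smul (proj_point smul u) \<inter> perp smul y \<inter>
                            (\<Inter>i\<in>{4..n}. perp smul (xs (\<sigma> i)))) = 1}
           in (\<Inter>i\<in>{4..n}. perp smul (xs (\<sigma> i))) \<inter> perp smul (proj_point smul u) \<inter>
                (\<Inter>y\<in>\<Omega>. perp smul y) = {}"
      unfolding Let_def
    proof (rule equals0I)
      fix z
      assume z: "z \<in> (\<Inter>i\<in>{4..n}. perp smul (xs (\<sigma> i))) \<inter> perp smul (proj_point smul u) \<inter>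
        (\<Inter>y\<in>{y \<in> pverts (bj_digraph smul). card (perp smul (proj_point smul u) \<inter> perp smul y \<inter>
                            (\<Inter>i\<in>{4..n}. perp smul (xs (\<sigma> i)))) = 1}. perp smul y)"
      then have "z \<in> points L" unfolding perpL[symmetric] by blast
      then obtain w where w: "w \<in> L" "w \<noteq> 0" "z = proj_point smul w" by (rule pointsE)
      obtain a g where a: "smooth_vector smul a" "supporting_functional smul a g" "g w \<noteq> 0"
        using smooth_vector_not_annihilating[OF w(2)] .
      have g: "scalar_linear g" using supporting_functional_linear[OF a(2)] .
      have perpa: "perp smul (proj_point smul a) = points {v. g v = 0}"
        by (rule perp_smooth_vector[OF a(1,2)])
      \<comment> \<open>Hence the vertex of \<open>a\<close> belongs to the set \<Omega>, while its
        hyperplane misses \<open>z\<close>.\<close>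
      have "dim (L \<inter> {v. g v = 0}) = 1"
        using dim_eq_dim_kernel[OF L g w(1) a(3)] \<open>dim L = 2\<close> by simp
      then have "card (points L \<inter> perp smul (proj_point smul a)) = 1"
        unfolding perpa points_Int[OF L subspace_kernel[OF g]]
        by (intro card_points_dim_1 subspace_inter L subspace_kernel g)
      then have "card (perp smul (proj_point smul u) \<inter> perp smul (proj_point smul a) \<inter>
                            (\<Inter>i\<in>{4..n}. perp smul (xs (\<sigma> i)))) = 1"
        unfolding perpL[symmetric] by (simp only: Int_ac)
      moreover have "proj_point smul a \<in> pverts (bj_digraph smul)"
        using a(1) by (auto simp: bj_digraph_def smooth_vector_def)
      ultimately have "z \<in> perp smul (proj_point smul a)" using z by blast
      then have "g w = 0"
        using w perpa proj_point_in_points_iff[OF subspace_kernel[OF g]] by simp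
      with a(3) show False by simp
    qed
  qed
qed

section \<open>From the vertices back to smoothness\<close>

lemma vertices_imp_smooth:
  fixes xs :: "nat \<Rightarrow> 'a set"
  assumes n: "n = dim (UNIV :: 'a set)" "n \<ge> 3" and u: "u \<noteq> 0"
    and xs: "\<And>i. i \<in> {3..n} \<Longrightarrow> xs i \<in> pverts (bj_digraph smul)"
    and one: "card (perp smul (proj_point smul u) \<inter> (\<Inter>i\<in>{3..n}. perp smul (xs i))) = 1"
    and empty: "\<And>\<sigma>. \<sigma> permutes {3..n} \<Longrightarrow>
       (\<Inter>i\<in>{4..n}. perp smul (xs (\<sigma> i))) \<inter> perp smul (proj_point smul u) \<inter>
         (\<Inter>y\<in>{y \<in> pverts (bj_digraph smul). card (perp smul (proj_point smul u) \<inter> perp smul y \<inter>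
             (\<Inter>i\<in>{4..n}. perp smul (xs (\<sigma> i)))) = 1}. perp smul y) = {}"
  shows "smooth_vector smul u"
proof (rule ccontr)
  assume "\<not> smooth_vector smul u"
  moreover obtain f where f: "supporting_functional smul u f"
    using supporting_functional_exists[OF u] .
  ultimately obtain g where g: "supporting_functional smul u g" "g \<noteq> f"
    using u by (auto simp: smooth_vector_def)
  have lf: "scalar_linear f" and lg: "scalar_linear g"
    using f g supporting_functional_linear by auto
  have "\<exists>y F. y \<noteq> 0 \<and> xs i = proj_point smul y \<and> supporting_functional smul y F" if "i \<in> {3..n}" for i
    using xs[OF that] supporting_functional_exists by (auto simp: bj_digraph_def) metis
  then obtain y F where y: "\<And>i. i \<in> {3..n} \<Longrightarrow> y i \<noteq> 0 \<and> xs i = proj_point smul (y i)"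
    and F: "\<And>i. i \<in> {3..n} \<Longrightarrow> supporting_functional smul (y i) (F i)"
    by metis
  have lF: "scalar_linear (F i)" if "i \<in> {3..n}" for i
    using F[OF that] by (rule supporting_functional_linear)
  define K where "K i = {v. F i v = 0}" for i
  have K: "subspace (K i)" if "i \<in> {3..n}" for i
    unfolding K_def using lF[OF that] by (rule subspace_kernel)
  have perp_xs: "points (K i) \<subseteq> perp smul (xs i)" if "i \<in> {3..n}" for i
    unfolding K_def using points_kernel_subset_perp[OF _ F[OF that]] y[OF that] by simp
  have perp_u: "points {v. h v = 0} \<subseteq> perp smul (proj_point smul u)" if "supporting_functional smul u h" for h
    using points_kernel_subset_perp[OF u that] .

  obtain p where p: "perp smul (proj_point smul u) \<inter> (\<Inter>i\<in>{3..n}. perp smul (xs i)) = {p}"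
    using one by (auto simp: card_1_singleton_iff)
  then have "p \<in> points UNIV"
    unfolding perp_def pverts_eq_points by blast
  then obtain w where w: "w \<noteq> 0" "p = proj_point smul w" by (auto elim: pointsE)
  define V where "V h = {v. h v = 0} \<inter> (\<Inter>i\<in>{3..n}. K i)" for h :: "'a \<Rightarrow> 'f"
  \<comment> \<open>For every \<open>h\<close> supporting at \<open>u\<close>, at most the point
    \<open>p\<close> survives, and a dimension count (n - 1) - (n - 2) = 1 shows that something
    does.\<close>
  have V: "w \<in> V h" "V h \<subseteq> span {w}" if h: "supporting_functional smul u h" for h
  proof -
    have lh: "scalar_linear h" using supporting_functional_linear[OF h] .
    have sub: "subspace (V h)"
      unfolding V_def using K by (intro subspace_inter subspace_Int subspace_kernel lh)
    have "points (V h) = points {v. h v = 0} \<inter> (\<Inter>i\<in>{3..n}. points (K i))"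
      unfolding V_def by (rule points_Int_INT[OF subspace_kernel[OF lh] K, symmetric])
    also have "\<dots> \<subseteq> {proj_point smul w}"
      using perp_u[OF h] perp_xs p w(2) by blast
    finally have *: "points (V h) \<subseteq> {proj_point smul w}" .
    then show "V h \<subseteq> span {w}" by (rule points_subset_singletonD)
    have "n \<le> dim {v. h v = 0} + 1"
      using dim_le_dim_kernel[OF subspace_UNIV lh] n by simp
    moreover have "dim {v. h v = 0} \<le> dim (V h) + card {3..n}"
      unfolding V_def K_def by (intro dim_le_dim_INT_kernels subspace_kernel lh lF) auto
    ultimately have "dim (V h) \<ge> 1" using n(2) by simp
    then have "proj_point smul w \<in> points (V h)" using points_nonempty * by blast
    then show "w \<in> V h" using proj_point_in_points_iff[OF sub w(1)] by simp
  qed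
  have gw: "g v = 0" if "v \<in> span {w}" for v
    using that V(1)[OF g(1)] by (auto simp: span_singleton V_def scalar_linear_smul[OF lg])

  txt \<open>
    Otherwise \<open>g\<close> would vanish on every \<open>M j\<close>, and these together span \<open>ker f\<close>, so that \<open>g = f\<close>.
  \<close>
  define M where "M j = {v. f v = 0} \<inter> (\<Inter>i\<in>{3..n} - {j}. K i)" for j
  have M_Int: "M j \<inter> K j = V f" if "j \<in> {3..n}" for j
    unfolding M_def V_def using that by blast
  have M_sub: "subspace (M j)" for j
    unfolding M_def using K by (intro subspace_inter subspace_Int subspace_kernel lf) auto
  have card_j: "card ({3..n} - {j}) + 3 = n" if "j \<in> {3..n}" for j
    using that by auto
  have "\<exists>j\<in>{3..n}. \<exists>e\<in>M j. g e \<noteq> 0"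
  proof (rule ccontr)
    assume "\<not> (\<exists>j\<in>{3..n}. \<exists>e\<in>M j. g e \<noteq> 0)"
    then have gM: "g e = 0" if "j \<in> {3..n}" "e \<in> M j" for j e using that by blast
    \<comment> \<open>Omitting one kernel leaves dimension at least 2, so \<open>M j\<close> cannot
      be contained in the line \<open>span {w}\<close>. The vectors found this way act as a dual
      system: \<open>F i (e j) = 0\<close> for \<open>i \<noteq> j\<close>.\<close>
    have "\<exists>e\<in>M j. F j e \<noteq> 0" if j: "j \<in> {3..n}" for j
    proof (rule ccontr)
      assume "\<not> (\<exists>e\<in>M j. F j e \<noteq> 0)"
      then have "M j \<subseteq> span {w}" using M_Int[OF j] V(2)[OF f] by (auto simp: K_def)
      then have "dim (M j) \<le> 1" using dim_le_card[of "M j" "{w}"] by simp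
      moreover have "n \<le> dim {v. f v = 0} + 1"
        using dim_le_dim_kernel[OF subspace_UNIV lf] n by simp
      moreover have "dim {v. f v = 0} \<le> dim (M j) + card ({3..n} - {j})"
        unfolding M_def K_def by (intro dim_le_dim_INT_kernels subspace_kernel lf lF) auto
      ultimately show False using card_j[OF j] n(2) by linarith
    qed
    then obtain e where e: "\<And>j. j \<in> {3..n} \<Longrightarrow> e j \<in> M j" "\<And>j. j \<in> {3..n} \<Longrightarrow> F j (e j) \<noteq> 0"
      by metis
    have ker: "g v = 0" if v: "f v = 0" for v
    proof -
      \<comment> \<open>The combination of the \<open>e j\<close> on which \<open>f\<close> and all
        \<open>F i\<close> agree with \<open>v\<close>; then \<open>v - s\<close> lies in
        \<open>V f\<close>, where \<open>g\<close> vanishes.\<close>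
      define s where "s = (\<Sum>j\<in>{3..n}. smul (F j v / F j (e j)) (e j))"
      have "f s = 0"
        unfolding s_def scalar_linear_sum[OF lf] scalar_linear_smul[OF lf] using e(1)
        by (intro sum.neutral) (auto simp: M_def)
      moreover have "F i s = F i v" if i: "i \<in> {3..n}" for i
      proof -
        have "F i s = (\<Sum>j\<in>{3..n}. if j = i then F i v else 0)"
          unfolding s_def scalar_linear_sum[OF lF[OF i]] scalar_linear_smul[OF lF[OF i]]
        proof (intro sum.cong refl)
          fix j assume j: "j \<in> {3..n}"
          show "F j v / F j (e j) * F i (e j) = (if j = i then F i v else 0)"
            using e[OF j] i by (auto simp: M_def K_def)
        qed
        then show ?thesis using i by simp
      qed
      ultimately have "v - s \<in> V f"
        using v by (auto simp: V_def K_def scalar_linear_diff[OF lf] scalar_linear_diff[OF lF])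
      then have "g (v - s) = 0" using V(2)[OF f] gw by blast
      moreover have "g s = 0"
        unfolding s_def scalar_linear_sum[OF lg] scalar_linear_smul[OF lg] using e(1) gM
        by (intro sum.neutral) auto
      ultimately show ?thesis by (simp add: scalar_linear_diff[OF lg])
    qed
    have fu: "f u = of_real (norm u)" "g u = of_real (norm u)"
      using f g by (auto simp: supporting_functional_def)
    \<comment> \<open>\<open>g\<close> vanishes on the kernel of \<open>f\<close> and takes the same
      nonzero value at \<open>u\<close>.\<close>
    have "g v = f v" for v
    proof -
      have "f (v - smul (f v / f u) u) = 0"
        using fu u by (simp add: scalar_linear_diff[OF lf] scalar_linear_smul[OF lf])
      then have "g (v - smul (f v / f u) u) = 0" by (rule ker)
      then show ?thesis
        using fu u by (simp add: scalar_linear_diff[OF lg] scalar_linear_smul[OF lg])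
    qed
    then show False using g(2) by auto
  qed
  then obtain j e where j: "j \<in> {3..n}" and e: "e \<in> M j" "g e \<noteq> 0" by blast
  \<comment> \<open>This is the exchange of \<open>g\<close> for \<open>F j\<close>. If
    \<open>F j v \<noteq> 0\<close>, subtracting a multiple of \<open>v\<close> from
    \<open>e\<close> lands in \<open>V f\<close>, where \<open>g\<close> vanishes, yet
    \<open>g\<close> still has the value \<open>g e \<noteq> 0\<close>.\<close>
  have N: "v \<in> span {w}" if v: "v \<in> M j" "g v = 0" for v
  proof -
    have "F j v = 0"
    proof (rule ccontr)
      assume Fv: "F j v \<noteq> 0"
      let ?d = "e - smul (F j e / F j v) v"
      have "?d \<in> M j" using e v M_sub by (intro subspace_diff subspace_scale)
      moreover have "F j ?d = 0"
        using Fv by (simp add: scalar_linear_diff[OF lF[OF j]] scalar_linear_smul[OF lF[OF j]])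
      ultimately have "?d \<in> V f" using M_Int[OF j] by (auto simp: K_def)
      then have "g ?d = 0" using V(2)[OF f] gw by blast
      then show False using v e by (simp add: scalar_linear_diff[OF lg] scalar_linear_smul[OF lg])
    qed
    then show ?thesis using v M_Int[OF j] V(2)[OF f] by (auto simp: K_def)
  qed

  \<comment> \<open>The index set {4..n} omits 3, so swapping 3 and \<open>j\<close> leaves out
    exactly the vertex \<open>xs j\<close>.\<close>
  define \<sigma> where "\<sigma> = Transposition.transpose 3 j"
  have \<sigma>: "\<sigma> permutes {3..n}"
    unfolding \<sigma>_def using j n(2) by (intro permutes_swap_id) auto
  have "\<sigma> ` {4..n} = {3..n} - {j}"
  proof -
    have "{4..n} = {3..n} - {3}" by auto
    then have "\<sigma> ` {4..n} = \<sigma> ` {3..n} - \<sigma> ` {3}"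
      by (simp add: image_set_diff[OF permutes_inj[OF \<sigma>]])
    then show ?thesis using permutes_image[OF \<sigma>] by (simp add: \<sigma>_def)
  qed
  then have INT_\<sigma>: "(\<Inter>i\<in>{4..n}. perp smul (xs (\<sigma> i))) = (\<Inter>i\<in>{3..n} - {j}. perp smul (xs i))"
    by (metis image_image)
  have "p \<in> perp smul z"
    if z: "z \<in> pverts (bj_digraph smul)"
      and card: "card (perp smul (proj_point smul u) \<inter> perp smul z \<inter> (\<Inter>i\<in>{4..n}. perp smul (xs (\<sigma> i)))) = 1" for z
  proof -
    obtain t where t: "t \<noteq> 0" "z = proj_point smul t" using z by (auto simp: bj_digraph_def)
    obtain h where h: "supporting_functional smul t h" using supporting_functional_exists[OF t(1)] .
    have lh: "scalar_linear h" using supporting_functional_linear[OF h] .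
    have perp_z: "points {v. h v = 0} \<subseteq> perp smul z"
      using points_kernel_subset_perp[OF t(1) h] t(2) by simp
    obtain p' where p': "perp smul (proj_point smul u) \<inter> perp smul z \<inter> (\<Inter>i\<in>{3..n} - {j}. perp smul (xs i)) = {p'}"
      using card unfolding INT_\<sigma> by (auto simp: card_1_singleton_iff)
    define W where "W k = ({v. k v = 0} \<inter> {v. h v = 0}) \<inter> (\<Inter>i\<in>{3..n} - {j}. K i)" for k :: "'a \<Rightarrow> 'f"
    have W_sub: "subspace (W k)" if "scalar_linear k" for k
      unfolding W_def using K that by (intro subspace_inter subspace_Int subspace_kernel lh) auto
    \<comment> \<open>The count (n - 1) - 1 - (n - 3) = 1 makes the common kernel nonzero, and its
      points lie in the singleton of \<open>p'\<close>. Taking \<open>k\<close> as \<open>f\<close>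
      and as \<open>g\<close> shows that both kill the same point.\<close>
    have W: "p' \<in> points (W k)" if k: "supporting_functional smul u k" for k
    proof -
      have lk: "scalar_linear k" using supporting_functional_linear[OF k] .
      let ?U = "{v. k v = 0} \<inter> {v. h v = 0}"
      have U: "subspace ?U" by (intro subspace_inter subspace_kernel lk lh)
      have "points (W k) = (points {v. k v = 0} \<inter> points {v. h v = 0}) \<inter> (\<Inter>i\<in>{3..n} - {j}. points (K i))"
        unfolding W_def points_Int[OF subspace_kernel[OF lk] subspace_kernel[OF lh]]
        by (rule points_Int_INT[OF U, symmetric]) (use K in simp)
      also have "\<dots> \<subseteq> {p'}"
        unfolding p'[symmetric] using perp_u[OF k] perp_xs perp_z by blast
      finally have "points (W k) \<subseteq> {p'}" .
      moreover have "n \<le> dim {v. k v = 0} + 1"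
        using dim_le_dim_kernel[OF subspace_UNIV lk] n by simp
      moreover have "dim {v. k v = 0} \<le> dim ?U + 1"
        by (intro dim_le_dim_kernel subspace_kernel lk lh)
      moreover have "dim ?U \<le> dim (W k) + card ({3..n} - {j})"
        unfolding W_def K_def by (intro dim_le_dim_INT_kernels U lF) auto
      ultimately have "dim (W k) \<ge> 1" using card_j[OF j] n(2) by linarith
      then show ?thesis using points_nonempty \<open>points (W k) \<subseteq> {p'}\<close> by blast
    qed
    obtain v where v: "v \<in> W f" "v \<noteq> 0" "p' = proj_point smul v" using W[OF f] by (rule pointsE)
    then have "v \<in> W g" using W[OF g(1)] proj_point_in_points_iff[OF W_sub[OF lg]] by simp
    \<comment> \<open>Now \<open>v\<close> is a nonzero multiple of \<open>w\<close>, so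
      \<open>h v = 0\<close> passes to \<open>w\<close> and \<open>p\<close> is a neighbour of
      \<open>z\<close>.\<close>
    then have "v \<in> span {w}" using N v(1) by (auto simp: W_def M_def)
    then obtain a where "v = smul a w" by (auto simp: span_singleton)
    moreover have "h v = 0" using v(1) by (simp add: W_def)
    ultimately have "h w = 0" using v(2) by (auto simp: scalar_linear_smul[OF lh])
    then show ?thesis using perp_z w by (auto simp: points_def)
  qed
  moreover have "p \<in> (\<Inter>i\<in>{4..n}. perp smul (xs (\<sigma> i))) \<inter> perp smul (proj_point smul u)"
    unfolding INT_\<sigma> using p by blast
  ultimately show False using empty[OF \<sigma>] by blast
qed

end

theorem lemma2p8:
  fixes smul :: "'f::real_or_complex \<Rightarrow> 'a::real_normed_vector \<Rightarrow> 'a"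
    and n :: nat
    and x :: "'a set"
  assumes "fin_dim_normed_space smul"
    and "n = vector_space.dim smul (UNIV :: 'a set)"
    and "n \<ge> 3"
    and "x \<in> pverts (bj_digraph smul)"
  shows "smooth_vertex smul x \<longleftrightarrow>
    (\<exists>xs :: nat \<Rightarrow> 'a set.
       (\<forall>i\<in>{3..n}. xs i \<in> pverts (bj_digraph smul)) \<and>
       card (perp smul x \<inter> (\<Inter>i\<in>{3..n}. perp smul (xs i))) = 1 \<and>
       (\<forall>\<sigma>. \<sigma> permutes {3..n} \<longrightarrow>
          (let \<Omega> = {y \<in> pverts (bj_digraph smul).
                      card (perp smul x \<inter> perp smul y \<inter>
                            (\<Inter>i\<in>{4..n}. perp smul (xs (\<sigma> i)))) = 1}
           in (\<Inter>i\<in>{4..n}. perp smul (xs (\<sigma> i))) \<inter> perp smul x \<inter>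
                (\<Inter>y\<in>\<Omega>. perp smul y) = {})))"
    (is "_ \<longleftrightarrow> (\<exists>xs. ?P xs)")
proof
  interpret fin_dim_normed_space smul by fact
  assume "smooth_vertex smul x"
  then obtain u where "x = proj_point smul u" "smooth_vector smul u"
    by (auto simp: smooth_vertex_def)
  then show "\<exists>xs. ?P xs"
    using smooth_imp_vertices[OF assms(2,3)] by simp
next
  interpret fin_dim_normed_space smul by fact
  assume "\<exists>xs. ?P xs"
  then obtain xs where xs: "?P xs" ..
  obtain u where u: "u \<noteq> 0" "x = proj_point smul u"
    using assms(4) by (auto simp: bj_digraph_def)
  have "smooth_vector smul u"
    by (rule vertices_imp_smooth[OF assms(2,3) u(1), of xs]) (use xs u(2) in \<open>simp_all add: Let_def\<close>)
  with u show "smooth_vertex smul x" by (auto simp: smooth_vertex_def)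
qed

end
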